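(* Consider the two-queue exhaustive polling system with partial information. (i) If $c(1-\rho)>d$: the Nash equilibrium policy is to join the idle queue. It is also a socially optimal policy. (ii) If $c(1-\rho)\le d<c$: the Nash equilibrium policy is to join the busy queue. It is not the socially optimal policy. (iii) If $c\le d$: the Nash equilibrium policy is to join the busy queue. It is also a socially optimal policy.
   Context: Polling model: customers arrive according to a Poisson process with rate $\lambda$ at a system with two queues. Service times are independent and exponentially distributed with rate $\mu$ in each queue, and $\rho=\lambda/\mu<1$. A single server serves the two queues cyclically with exhaustive service: it serves a queue until that queue is empty and then moves to the other queue. Switch-over times are zero. The only costs are waiting costs: a customer pays $c$ per unit time while she is in a queue that is being served (her own service time included), and $d$ per unit time while she is in a queue that is not being served. Partial information: all customers know which queue is being served by the server, but not the individual queue lengths. The queue where the server is located is called the busy queue, the other one the idle queue. If both queues are empty after a service completion, the server stays at the queue it served last, so the busy queue and the idle queue are well defined at all times. A policy is a number $p\in[0,1]$: each customer joins the busy queue with probability $p$ and the idle queue with probability $1-p$. "Join the busy queue" is the policy $p=1$ and "join the idle queue" is the policy $p=0$. Let $C_B(p)$ and $C_I(p)$ be the expected total cost of a customer who arrives in steady state, when all other customers follow policy $p$, and who joins the busy queue, respectively the idle queue. A policy is socially optimal if it minimizes the expected cost $p\,C_B(p)+(1-p)\,C_I(p)$ of an arriving customer in steady state over $p\in[0,1]$. A policy $p$ is a Nash equilibrium (individually optimal) policy if, when all other customers follow $p$, a customer who wants to minimize her own expected cost can do so by also following $p$, that is, if $q=p$ minimizes $q\,C_B(p)+(1-q)\,C_I(p)$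 over $q\in[0,1]$.
   Formalization: The Nash equilibrium is proved to exist in all cases and to be unique except when c(1-ρ)=d in (ii), where every policy is an equilibrium, or c=d=0 in (iii), where all costs vanish; c,d ≥ 0, λ > 0 and service in order of arrival are assumed. *)

theory Defs
  imports "HOL-Probability.Probability"
begin

text \<open>
  The system state is a pair (number of customers in the busy queue, number of customers in the
  idle queue), customers in service included. Switch-over times are zero, so a state in
  which the busy queue is empty and the idle queue is not is left immediately.
\<close>

type_synonym state = "nat \<times> nat"

definition states :: "state set" where
  "states = {(i, j). i = 0 \<longrightarrow> j = 0}"

definition switch_if_empty :: "state \<Rightarrow> state" where
  "switch_if_empty = (\<lambda>(i, j). if i = 0 then (j, 0) else (i, j))"

definition join_busy :: "state \<Rightarrow> state" where
  "join_busy = (\<lambda>(i, j). (i + 1, j))"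

definition join_idle :: "state \<Rightarrow> state" where
  "join_idle = (\<lambda>(i, j). switch_if_empty (i, j + 1))"

definition serve :: "state \<Rightarrow> state" where
  "serve = (\<lambda>(i, j). switch_if_empty (i - 1, j))"

text \<open>
  Transition rates of the continuous-time Markov chain under policy \<open>p\<close>. In the empty system
  both ways of joining lead to the state (1, 0), and the two rates add up.
\<close>

definition rate :: "real \<Rightarrow> real \<Rightarrow> real \<Rightarrow> state \<Rightarrow> state \<Rightarrow> real" where
  "rate lam mu p s s' =
     (if s' = join_busy s then lam * p else 0)
   + (if s' = join_idle s then lam * (1 - p) else 0)
   + (if fst s > 0 \<and> s' = serve s then mu else 0)"

definition stationary_distribution :: "real \<Rightarrow> real \<Rightarrow> real \<Rightarrow> state pmf \<Rightarrow> bool" where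
  "stationary_distribution lam mu p \<pi> \<longleftrightarrow>
     set_pmf \<pi> \<subseteq> states \<and>
     (\<forall>s\<in>states. (\<Sum>\<^sub>\<infinity>s'\<in>states. pmf \<pi> s * rate lam mu p s s') = (\<Sum>\<^sub>\<infinity>s'\<in>states. pmf \<pi> s' * rate lam mu p s' s))"

definition steady_state :: "real \<Rightarrow> real \<Rightarrow> real \<Rightarrow> state pmf" where
  "steady_state lam mu p = (THE \<pi>. stationary_distribution lam mu p \<pi>)"

text \<open>
  What happens after the arrival of a tagged customer is driven by the interarrival times \<open>A\<close> of
  the Poisson process of later customers, their choices \<open>B\<close> (true: join the busy queue), and the
  successive service times \<open>S\<close>; \<open>S 0\<close> is the residual service time of the customer in service
  on arrival, if there is one, which is exponential as well by lack of memory.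
\<close>

type_synonym future = "(nat \<Rightarrow> real) \<times> (nat \<Rightarrow> bool) \<times> (nat \<Rightarrow> real)"

definition exponential :: "real \<Rightarrow> real measure" where
  "exponential r = density lborel (exponential_density r)"

definition future_measure :: "real \<Rightarrow> real \<Rightarrow> real \<Rightarrow> future measure" where
  "future_measure lam mu p =
     (\<Pi>\<^sub>M n\<in>UNIV. exponential lam) \<Otimes>\<^sub>M
     ((\<Pi>\<^sub>M n\<in>UNIV. measure_pmf (bernoulli_pmf p)) \<Otimes>\<^sub>M
      (\<Pi>\<^sub>M n\<in>UNIV. exponential mu))"

text \<open>
  By PASTA the tagged customer finds the system in its stationary distribution, independently of
  the future.
\<close>

definition tagged_space :: "real \<Rightarrow> real \<Rightarrow> real \<Rightarrow> (state \<times> future) measure" where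
  "tagged_space lam mu p = measure_pmf (steady_state lam mu p) \<Otimes>\<^sub>M future_measure lam mu p"

definition arrival_time :: "(nat \<Rightarrow> real) \<Rightarrow> nat \<Rightarrow> real" where
  "arrival_time A n = (\<Sum>k\<le>n. A k)"

definition completion_time :: "(nat \<Rightarrow> real) \<Rightarrow> nat \<Rightarrow> real" where
  "completion_time S m = (\<Sum>k<m. S k)"

text \<open>
  The number of customers that have joined the busy queue up to time \<open>t\<close> after the tagged
  arrival, as long as the server has not left it. (The set is almost surely finite.)
\<close>

definition busy_arrivals :: "(nat \<Rightarrow> real) \<Rightarrow> (nat \<Rightarrow> bool) \<Rightarrow> real \<Rightarrow> nat" where
  "busy_arrivals A B t = card {n. arrival_time A n \<le> t \<and> B n}"

text \<open>
  The number of services until the busy queue, initially of length \<open>i\<close>, is empty for the first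
  time. It exists almost surely when \<open>lam < mu\<close>.
\<close>

definition services_until_empty :: "nat \<Rightarrow> future \<Rightarrow> nat" where
  "services_until_empty i =
     (\<lambda>(A, B, S). LEAST m. i + busy_arrivals A B (completion_time S m) = m)"

text \<open>
  Time spent by the tagged customer in a queue that is (is not) being served. Each queue is
  served in order of arrival. If she joins the busy queue, it is served until she leaves.
  If she joins the idle queue, the server arrives there when the busy queue is empty, and then
  serves the customers ahead of her and herself.
\<close>

definition time_served_join_busy :: "state \<times> future \<Rightarrow> real" where
  "time_served_join_busy = (\<lambda>((i, j), (A, B, S)). \<Sum>k<i + 1. S k)"

definition time_unserved_join_idle :: "state \<times> future \<Rightarrow> real" where
  "time_unserved_join_idle =
     (\<lambda>((i, j), (A, B, S)). completion_time S (services_until_empty i (A, B, S)))"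

definition time_served_join_idle :: "state \<times> future \<Rightarrow> real" where
  "time_served_join_idle =
     (\<lambda>((i, j), (A, B, S)). \<Sum>k<j + 1. S (services_until_empty i (A, B, S) + k))"

text \<open>
  Expected costs are nonnegative integrals with values in \<open>[0, \<infinity>]\<close>, so that no
  integrability has to be assumed.
\<close>

definition cost_busy :: "real \<Rightarrow> real \<Rightarrow> real \<Rightarrow> real \<Rightarrow> real \<Rightarrow> ennreal" where
  "cost_busy lam mu c d p =
     (\<integral>\<^sup>+ x. ennreal (c * time_served_join_busy x) \<partial>tagged_space lam mu p)"

definition cost_idle :: "real \<Rightarrow> real \<Rightarrow> real \<Rightarrow> real \<Rightarrow> real \<Rightarrow> ennreal" where
  "cost_idle lam mu c d p =
     (\<integral>\<^sup>+ x. ennreal (d * time_unserved_join_idle x + c * time_served_join_idle x)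
        \<partial>tagged_space lam mu p)"

text \<open>
  Expected cost of a customer who joins the busy queue with probability \<open>q\<close> when all others
  follow policy \<open>p\<close>.
\<close>

definition expected_cost :: "real \<Rightarrow> real \<Rightarrow> real \<Rightarrow> real \<Rightarrow> real \<Rightarrow> real \<Rightarrow> ennreal" where
  "expected_cost lam mu c d q p =
     ennreal q * cost_busy lam mu c d p + ennreal (1 - q) * cost_idle lam mu c d p"

definition socially_optimal :: "real \<Rightarrow> real \<Rightarrow> real \<Rightarrow> real \<Rightarrow> real \<Rightarrow> bool" where
  "socially_optimal lam mu c d p \<longleftrightarrow>
     p \<in> {0..1} \<and>
     (\<forall>q\<in>{0..1}. expected_cost lam mu c d p p \<le> expected_cost lam mu c d q q)"

definition nash_equilibrium :: "real \<Rightarrow> real \<Rightarrow> real \<Rightarrow> real \<Rightarrow> real \<Rightarrow> bool" where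
  "nash_equilibrium lam mu c d p \<longleftrightarrow>
     p \<in> {0..1} \<and>
     (\<forall>q\<in>{0..1}. expected_cost lam mu c d p p \<le> expected_cost lam mu c d q p)"

end

theory Submission imports Defs begin

text \<open>
  Let \<open>x\<close> and \<open>y\<close> be the mean stationary lengths of the busy and the idle queue. The total number
  of customers is an M/M/1 queue for every policy, so \<open>x + y = \<rho> / (1 - \<rho>)\<close>, and balance of the
  product of the two lengths gives \<open>(\<mu> - \<lambda>p) y = \<lambda>(1 - p) x\<close>. The residual busy period seen by the
  tagged customer has mean \<open>x / (\<mu> - \<lambda>p)\<close>: conditioning on the first event yields a linear
  recurrence in the initial queue length, only one solution of which grows linearly. Hence
  \<open>C\<^sub>I(p) - C\<^sub>B(p)\<close> is a positive multiple of \<open>d - c(1 - \<rho>)\<close>, while the cost under policy \<open>p\<close> is,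
  up to an increasing affine transformation independent of \<open>p\<close>,
  \<open>(d - c)(1 - p) / (1 + \<rho> - 2\<rho>p)\<close>.
\<close>

section \<open>Invariant measures of Markov kernels on countable sets\<close>

text \<open>Two definitions have to be tamed before any mean can be computed.
  \<open>steady_state\<close> is a definite description, so the stationary law must be shown to
  exist and to be unique. Uniqueness rests on one number: the M/M/1 projection forces every
  stationary law to give the empty state the same mass. For existence the joint law is not written
  down but obtained as a normalised occupation measure; measures are kept as \<open>ennreal\<close>
  weights until then, so that sums need no convergence proofs. \<open>services_until_empty\<close>
  is a LEAST, hence arbitrary on futures where the busy queue never empties, and the costs could a
  priori be infinite, so the linear recurrence cannot be used directly. Expectations are first
  restricted to emptying within \<open>n\<close> events, where they stay below the candidate
  solution, and then \<open>n\<close> tends to infinity. Applied to the constant functional 1, this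
  scheme shows that the queue empties almost surely; that result is then an input for the length of
  the residual busy period.\<close>

definition push :: "('a \<Rightarrow> 'a pmf) \<Rightarrow> ('a \<Rightarrow> ennreal) \<Rightarrow> 'a \<Rightarrow> ennreal" where
  "push K w x = (\<integral>\<^sup>+ s. w s * ennreal (pmf (K s) x) \<partial>count_space UNIV)"

lemma pmf_bind_eq_push: "ennreal (pmf (bind_pmf \<pi> K) x) = push K (\<lambda>s. ennreal (pmf \<pi> s)) x"
  by (simp add: ennreal_pmf_bind nn_integral_measure_pmf push_def)

text \<open>Tonelli over source and target states. It moves one step of the chain from the measure
  to the test function: \<open>f = 1\<close> yields conservation of mass, the number of customers
  yields the drift argument.\<close>

lemma nn_integral_push:
  fixes K :: "'a::countable \<Rightarrow> 'a pmf"
  shows "(\<integral>\<^sup>+ x. push K w x * f x \<partial>count_space UNIV)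
       = (\<integral>\<^sup>+ s. w s * (\<integral>\<^sup>+ x. f x \<partial>measure_pmf (K s)) \<partial>count_space UNIV)"
proof -
  have "(\<integral>\<^sup>+ x. push K w x * f x \<partial>count_space UNIV)
      = (\<integral>\<^sup>+ x. \<integral>\<^sup>+ s. w s * ennreal (pmf (K s) x) * f x \<partial>count_space UNIV \<partial>count_space UNIV)"
    by (simp add: push_def nn_integral_multc)
  also have "\<dots> = (\<integral>\<^sup>+ s. \<integral>\<^sup>+ x. w s * ennreal (pmf (K s) x) * f x \<partial>count_space UNIV \<partial>count_space UNIV)"
    using nn_integral_fst_count_space[of "\<lambda>(x, s). w s * ennreal (pmf (K s) x) * f x"]
      nn_integral_snd_count_space[of "\<lambda>(x, s). w s * ennreal (pmf (K s) x) * f x"]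
    by simp
  also have "\<dots> = (\<integral>\<^sup>+ s. w s * (\<integral>\<^sup>+ x. f x \<partial>measure_pmf (K s)) \<partial>count_space UNIV)"
    by (simp add: nn_integral_measure_pmf nn_integral_cmult mult.assoc)
  finally show ?thesis .
qed

lemma nn_integral_push_1:
  fixes K :: "'a::countable \<Rightarrow> 'a pmf"
  shows "(\<integral>\<^sup>+ x. push K w x \<partial>count_space UNIV) = (\<integral>\<^sup>+ s. w s \<partial>count_space UNIV)"
  using nn_integral_push[of K w "\<lambda>_. 1"] by simp

lemma push_mono: "(\<And>s. v s \<le> w s) \<Longrightarrow> push K v x \<le> push K w x"
  unfolding push_def by (intro nn_integral_mono mult_right_mono) auto

text \<open>A kernel preserves total mass, so a finite excessive measure is invariant.\<close>

lemma excessive_invariant: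
  fixes K :: "'a::countable \<Rightarrow> 'a pmf"
  assumes fin: "(\<integral>\<^sup>+ s. w s \<partial>count_space UNIV) < \<infinity>" and le: "\<And>x. push K w x \<le> w x"
  shows "push K w x = w x"
proof -
  have eq: "(\<integral>\<^sup>+ x. w x - push K w x \<partial>count_space UNIV) = 0"
    using fin le by (subst nn_integral_diff) (auto simp: nn_integral_push_1 less_top)
  have "AE x in count_space UNIV. w x - push K w x = 0"
    using eq by (subst (asm) nn_integral_0_iff_AE) auto
  then have "w x - push K w x = 0" by (simp add: AE_count_space)
  then have "w x \<le> push K w x" using diff_eq_0_iff_ennreal
    by metis
  with le show ?thesis by (metis antisym)
qed

text \<open>The only passage from weights back to laws. It serves twice: for the excess of one
  invariant law over another (uniqueness) and for the occupation measure of an excursion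
  (existence).\<close>

lemma normalise_invariant:
  fixes K :: "'a::countable \<Rightarrow> 'a pmf"
  assumes inv: "\<And>x. push K w x = w x"
    and M: "(\<integral>\<^sup>+ s. w s \<partial>count_space UNIV) = M" "M \<noteq> 0" "M \<noteq> \<infinity>"
  obtains \<pi> where "bind_pmf \<pi> K = \<pi>" "\<And>s. ennreal (pmf \<pi> s) = w s / M"
proof -
  define f where "f s = enn2real (w s / M)" for s
  have wle: "w s \<le> M" for s
    using nn_integral_ge_point[of s UNIV w] M(1) by simp
  have fe: "ennreal (f s) = w s / M" for s
    unfolding f_def using wle[of s] M
    by (intro ennreal_enn2real) (metis ennreal_divide_eq_top_iff infinity_ennreal_def less_top neq_top_trans)
  have f1: "(\<integral>\<^sup>+ s. ennreal (f s) \<partial>count_space UNIV) = 1"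
    using M by (simp add: fe nn_integral_divide ennreal_divide_self less_top)
  have pf: "ennreal (pmf (embed_pmf f) s) = w s / M" for s
    by (subst pmf_embed_pmf) (use f1 in \<open>simp_all add: fe enn2real_nonneg[of "w _ / M", folded f_def]\<close>)
  have "ennreal (pmf (bind_pmf (embed_pmf f) K) s) = ennreal (pmf (embed_pmf f) s)" for s
  proof -
    have "ennreal (pmf (bind_pmf (embed_pmf f) K) s) = push K (\<lambda>s. w s / M) s"
      by (simp add: pmf_bind_eq_push pf)
    also have "\<dots> = push K w s / M"
      by (simp add: push_def divide_ennreal_def nn_integral_cmult mult_ac)
    finally show ?thesis by (simp add: inv pf)
  qed
  then have "bind_pmf (embed_pmf f) K = embed_pmf f" by (intro pmf_eqI) simp
  with pf that show ?thesis by blast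
qed

text \<open>
  The minimum of two invariant laws is excessive, hence invariant; the part of the first law
  exceeding it, if nonzero, can be normalised to an invariant law without mass at \<open>a\<close>.
\<close>

lemma invariant_pmf_unique:
  fixes K :: "'a::countable \<Rightarrow> 'a pmf"
  assumes charge: "\<And>\<pi>. bind_pmf \<pi> K = \<pi> \<Longrightarrow> set_pmf \<pi> \<subseteq> X \<Longrightarrow> pmf \<pi> a = q" and q: "q > 0"
    and inv: "bind_pmf \<pi>1 K = \<pi>1" "bind_pmf \<pi>2 K = \<pi>2"
    and supp: "set_pmf \<pi>1 \<subseteq> X" "set_pmf \<pi>2 \<subseteq> X"
  shows "\<pi>1 = \<pi>2"
proof -
  define m where "m s = min (ennreal (pmf \<pi>1 s)) (ennreal (pmf \<pi>2 s))" for s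
  define w where "w s = ennreal (pmf \<pi>1 s) - m s" for s
  have inv1: "push K (\<lambda>s. ennreal (pmf \<pi>1 s)) x = ennreal (pmf \<pi>1 x)"
   and inv2: "push K (\<lambda>s. ennreal (pmf \<pi>2 s)) x = ennreal (pmf \<pi>2 x)" for x
    using inv by (simp_all flip: pmf_bind_eq_push)
  have mle: "m s \<le> ennreal (pmf \<pi>1 s)" "m s \<le> ennreal (pmf \<pi>2 s)" for s by (auto simp: m_def)
  have m_le1: "(\<integral>\<^sup>+ s. m s \<partial>count_space UNIV) \<le> 1"
    using nn_integral_mono[of "count_space UNIV" m "\<lambda>s. ennreal (pmf \<pi>1 s)"] mle
    by (simp add: nn_integral_pmf)
  have fin: "(\<integral>\<^sup>+ s. m s \<partial>count_space UNIV) < \<infinity>"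
    using m_le1 by (metis ennreal_one_less_top infinity_ennreal_def order_le_less_trans)
  have "push K m x \<le> m x" for x
    using push_mono[of m "\<lambda>s. ennreal (pmf \<pi>1 s)" K x] push_mono[of m "\<lambda>s. ennreal (pmf \<pi>2 s)" K x] mle
    by (auto simp: inv1 inv2 m_def)
  then have m: "push K m x = m x" for x using excessive_invariant[OF fin] by blast
  have w: "push K w x = w x" for x
  proof -
    have fx: "push K m x \<noteq> \<infinity>" using m[of x] mle(1)[of x] by (auto simp: top_unique)
    have dec: "ennreal (pmf \<pi>1 s) = m s + w s" for s
      using mle(1)[of s] by (simp add: w_def add_diff_inverse_ennreal)
    have "m x + w x = push K (\<lambda>s. ennreal (pmf \<pi>1 s)) x" by (simp add: inv1 flip: dec)
    also have "\<dots> = push K m x + push K w x"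
      by (simp add: dec push_def distrib_right nn_integral_add)
    finally show ?thesis using fx by (simp add: m ennreal_add_left_cancel)
  qed
  have w0: "(\<integral>\<^sup>+ s. w s \<partial>count_space UNIV) = 0"
  proof (rule ccontr)
    assume nz: "(\<integral>\<^sup>+ s. w s \<partial>count_space UNIV) \<noteq> 0"
    have "(\<integral>\<^sup>+ s. w s \<partial>count_space UNIV) \<le> (\<integral>\<^sup>+ s. ennreal (pmf \<pi>1 s) \<partial>count_space UNIV)"
      by (intro nn_integral_mono) (simp add: w_def diff_le_self_ennreal)
    then have "(\<integral>\<^sup>+ s. w s \<partial>count_space UNIV) \<noteq> \<infinity>"
      by (auto simp: nn_integral_pmf top_unique)
    from normalise_invariant[OF w refl nz this] obtain \<sigma> where \<sigma>: "bind_pmf \<sigma> K = \<sigma>"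
      "\<And>s. ennreal (pmf \<sigma> s) = w s / (\<integral>\<^sup>+ s. w s \<partial>count_space UNIV)" by blast
    \<comment> \<open>The excess is carried by the support of \<open>\<pi>1\<close>, so
      \<open>charge\<close> applies to the normalised excess and contradicts its zero mass at
      \<open>a\<close>.\<close>
    have "s \<in> X" if "s \<in> set_pmf \<sigma>" for s
    proof -
      have "pmf \<sigma> s > 0" using that by (simp add: pmf_positive_iff)
      then have "w s \<noteq> 0" using \<sigma>(2)[of s] by (auto simp: ennreal_eq_0_iff)
      then have "pmf \<pi>1 s > 0" unfolding w_def by (metis diff_eq_0_ennreal ennreal_0 ennreal_less_top linorder_not_le m_def mle(1) order_antisym_conv pmf_nonneg zero_le)
      then show ?thesis using supp by (auto simp: pmf_positive_iff)
    qed
    then have "pmf \<sigma> a = q" using charge[OF \<sigma>(1)] by blast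
    moreover have "w a = 0"
      using charge[OF inv(1) supp(1)] charge[OF inv(2) supp(2)] by (simp add: w_def m_def)
    ultimately show False using \<sigma>(2)[of a] q by simp
  qed
  \<comment> \<open>One inequality suffices: of two different laws, each has a point where it lies
    below the other.\<close>
  have "pmf \<pi>1 s \<le> pmf \<pi>2 s" for s
  proof -
    have "AE s in count_space UNIV. w s = 0" using w0 by (subst (asm) nn_integral_0_iff_AE) auto
    then have "w s = 0" by (simp add: AE_count_space)
    then have "ennreal (pmf \<pi>1 s) \<le> m s" unfolding w_def
      by (metis diff_gr0_ennreal ennreal_less_top less_irrefl linorder_not_le mle(1) order_le_less_trans)
    then show ?thesis using mle(2)[of s] by (metis ennreal_le_iff order_trans pmf_nonneg)
  qed
  then show ?thesis by (metis leD pmf_neq_exists_less)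
qed

section \<open>The stationary distribution of the polling system\<close>

text \<open>
  The uniformised chain. In the empty system \<open>serve\<close> is a self-loop, which makes up for the
  missing service rate.
\<close>

definition step_pmf :: "real \<Rightarrow> real \<Rightarrow> real \<Rightarrow> state \<Rightarrow> state pmf" where
  "step_pmf lam mu p s =
     bind_pmf (bernoulli_pmf (lam / (lam + mu)))
       (\<lambda>a. if a then map_pmf (\<lambda>b. if b then join_busy s else join_idle s) (bernoulli_pmf p)
            else return_pmf (serve s))"

text \<open>Bridge between integrals over counting measure, in which laws are handled, and unordered
  sums, in which the balance equations are written.\<close>

lemma has_sum_infsetsum:
  fixes f :: "'a \<Rightarrow> real"
  assumes "integrable (count_space UNIV) f"
  shows "(f has_sum (\<Sum>\<^sub>ax. f x)) UNIV"
proof -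
  have "Infinite_Set_Sum.abs_summable_on f UNIV"
    using assms by (simp add: Infinite_Set_Sum.abs_summable_on_def)
  then show ?thesis
    by (metis abs_summable_equivalent abs_summable_summable has_sum_infsum infsetsum_infsum)
qed

section \<open>Balance equations as invariance under the uniformised kernel\<close>

locale polling =
  fixes lam mu p :: real
  assumes lam_pos: "0 < lam" and lam_less: "lam < mu" and p_nonneg: "0 \<le> p" and p_le_1: "p \<le> 1"
begin

abbreviation "K \<equiv> step_pmf lam mu p"

lemma mu_pos: "0 < mu" using lam_pos lam_less by simp

lemma lam_ratio: "0 \<le> lam / (lam + mu)" "lam / (lam + mu) \<le> 1" "1 - lam / (lam + mu) = mu / (lam + mu)"
  using lam_pos mu_pos by (auto simp: field_simps)

lemma nn_integral_step:
  "(\<integral>\<^sup>+ x. f x \<partial>measure_pmf (K s))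
   = ennreal (lam * p / (lam + mu)) * f (join_busy s)
   + ennreal (lam * (1 - p) / (lam + mu)) * f (join_idle s)
   + ennreal (mu / (lam + mu)) * f (serve s)"
proof -
  have "(\<integral>\<^sup>+ x. f x \<partial>measure_pmf (K s)) =
     (ennreal p * f (join_busy s) + ennreal (1 - p) * f (join_idle s)) * ennreal (lam / (lam + mu))
     + f (serve s) * ennreal (mu / (lam + mu))"
    using lam_ratio p_nonneg p_le_1 by (simp add: step_pmf_def mult.commute)
  also have "\<dots> = ennreal (lam * p / (lam + mu)) * f (join_busy s)
   + ennreal (lam * (1 - p) / (lam + mu)) * f (join_idle s)
   + ennreal (mu / (lam + mu)) * f (serve s)"
  proof -
    have "ennreal (lam * p / (lam + mu)) = ennreal p * ennreal (lam / (lam + mu))"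
      "ennreal (lam * (1 - p) / (lam + mu)) = ennreal (1 - p) * ennreal (lam / (lam + mu))"
      using lam_pos mu_pos p_nonneg p_le_1 by (simp_all flip: ennreal_mult add: mult.commute)
    then show ?thesis by (simp add: algebra_simps)
  qed
  finally show ?thesis .
qed

lemma pmf_step:
  "(lam + mu) * pmf (K s) x =
     (if x = join_busy s then lam * p else 0)
   + (if x = join_idle s then lam * (1 - p) else 0)
   + (if x = serve s then mu else 0)"
proof -
  have "ennreal (pmf (K s) x) = (\<integral>\<^sup>+ y. indicator {x} y \<partial>measure_pmf (K s))"
    by (simp add: emeasure_pmf_single)
  also have "\<dots> = ennreal (((if x = join_busy s then lam * p else 0)
     + (if x = join_idle s then lam * (1 - p) else 0) + (if x = serve s then mu else 0)) / (lam + mu))"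
    unfolding nn_integral_step using lam_pos mu_pos p_nonneg p_le_1
    by (auto simp: indicator_def add_divide_distrib simp flip: ennreal_plus)
  finally show ?thesis using lam_pos mu_pos p_nonneg p_le_1 by (subst (asm) ennreal_inj) (auto simp: field_simps)
qed

lemma set_pmf_step: "s \<in> states \<Longrightarrow> set_pmf (K s) \<subseteq> states"
  by (auto simp: step_pmf_def states_def join_busy_def join_idle_def serve_def switch_if_empty_def
      split: if_splits prod.splits)

text \<open>Truncated subtraction gives \<open>serve (0, 0) = (0, 0)\<close>, a self-loop that
  \<open>rate\<close> does not contain; everywhere else in \<open>states\<close> the kernel is just
  the rates divided by \<open>lam + mu\<close>.\<close>

lemma rate_eq_step:
  assumes "s \<in> states"
  shows "rate lam mu p s x = (lam + mu) * pmf (K s) x - (if s = (0, 0) \<and> x = (0, 0) then mu else 0)"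
  using assms by (auto simp: pmf_step rate_def states_def serve_def switch_if_empty_def)

lemma has_sum_pmf_bind:
  assumes "set_pmf \<pi> \<subseteq> states"
  shows "((\<lambda>s. pmf \<pi> s * pmf (K s) x) has_sum pmf (bind_pmf \<pi> K) x) states"
proof -
  have i: "integrable (measure_pmf \<pi>) (\<lambda>s. pmf (K s) x)"
    by (intro measure_pmf.integrable_const_bound[of _ 1]) (auto simp: pmf_le_1)
  then have "integrable (count_space UNIV) (\<lambda>s. pmf \<pi> s * pmf (K s) x)"
    unfolding measure_pmf_eq_density by (subst (asm) integrable_density) auto
  then have "((\<lambda>s. pmf \<pi> s * pmf (K s) x) has_sum (\<Sum>\<^sub>as. pmf \<pi> s * pmf (K s) x)) UNIV"
    by (rule has_sum_infsetsum)
  moreover have "(\<Sum>\<^sub>as. pmf \<pi> s * pmf (K s) x) = pmf (bind_pmf \<pi> K) x"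
    by (simp add: pmf_bind pmf_expectation_eq_infsetsum)
  ultimately have "((\<lambda>s. pmf \<pi> s * pmf (K s) x) has_sum pmf (bind_pmf \<pi> K) x) UNIV" by simp
  then show ?thesis using assms
    by (elim has_sum_cong_neutral[THEN iffD1, rotated -1]) (auto simp: set_pmf_iff)
qed

lemma balance_out:
  assumes "s \<in> states"
  shows "(\<Sum>\<^sub>\<infinity>x\<in>states. c * rate lam mu p s x) = c * ((lam + mu) - (if s = (0, 0) then mu else 0))"
proof -
  have "((\<lambda>x. pmf (K s) x) has_sum 1) states"
  proof -
    have "(pmf (K s) has_sum 1) UNIV"
      using has_sum_infsetsum[of "pmf (K s)"] infsetsum_pmf_eq_1[of "K s" UNIV]
        pmf_abs_summable[of "K s" UNIV] by (simp add: Infinite_Set_Sum.abs_summable_on_def)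
    then show ?thesis using set_pmf_step[OF assms]
      by (elim has_sum_cong_neutral[THEN iffD1, rotated -1]) (auto simp: set_pmf_iff)
  qed
  from has_sum_cmult_right[OF this, of "c * (lam + mu)"]
  have 1: "((\<lambda>x. c * (lam + mu) * pmf (K s) x) has_sum (c * (lam + mu))) states" by simp
  have "((\<lambda>x. if x = (0, 0) then - c * (if s = (0, 0) then mu else 0) else 0) has_sum
     (- c * (if s = (0, 0) then mu else 0))) states"
    by (rule has_sum_finite_neutralI[of "{(0, 0)}"]) (auto simp: states_def)
  from has_sum_add[OF 1 this]
  have "((\<lambda>x. c * rate lam mu p s x) has_sum
      (c * (lam + mu) + - c * (if s = (0, 0) then mu else 0))) states"
    by (rule has_sum_cong[THEN iffD1, rotated])
       (use assms in \<open>auto simp: rate_eq_step algebra_simps\<close>)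
  then show ?thesis by (auto dest!: infsumI simp: algebra_simps)
qed

lemma balance_in:
  assumes "set_pmf \<pi> \<subseteq> states"
  shows "(\<Sum>\<^sub>\<infinity>s\<in>states. pmf \<pi> s * rate lam mu p s x)
    = (lam + mu) * pmf (bind_pmf \<pi> K) x - (if x = (0, 0) then mu * pmf \<pi> x else 0)"
proof -
  from has_sum_cmult_right[OF has_sum_pmf_bind[OF assms], of "lam + mu" x]
  have 1: "((\<lambda>s. (lam + mu) * (pmf \<pi> s * pmf (K s) x)) has_sum ((lam + mu) * pmf (bind_pmf \<pi> K) x)) states" .
  have "((\<lambda>s. if s = (0, 0) then - (if x = (0, 0) then mu * pmf \<pi> x else 0) else 0) has_sum
     (- (if x = (0, 0) then mu * pmf \<pi> x else 0))) states"
    by (rule has_sum_finite_neutralI[of "{(0, 0)}"]) (auto simp: states_def)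
  from has_sum_add[OF 1 this]
  have "((\<lambda>s. pmf \<pi> s * rate lam mu p s x) has_sum
     ((lam + mu) * pmf (bind_pmf \<pi> K) x + - (if x = (0, 0) then mu * pmf \<pi> x else 0))) states"
    by (rule has_sum_cong[THEN iffD1, rotated])
       (use assms in \<open>auto simp: rate_eq_step algebra_simps\<close>)
  then show ?thesis by (auto dest!: infsumI)
qed

text \<open>The self-loop contributes the same amount to inflow and outflow of the empty state and
  cancels. The balance equations only concern \<open>states\<close>; elsewhere both masses vanish,
  because the kernel does not leave \<open>states\<close>.\<close>

lemma stationary_iff_invariant:
  "stationary_distribution lam mu p \<pi> \<longleftrightarrow> set_pmf \<pi> \<subseteq> states \<and> bind_pmf \<pi> K = \<pi>"
proof (cases "set_pmf \<pi> \<subseteq> states")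
  case True
  have L: "lam + mu \<noteq> 0" using lam_pos mu_pos by simp
  have "(\<Sum>\<^sub>\<infinity>s'\<in>states. pmf \<pi> s * rate lam mu p s s') = (\<Sum>\<^sub>\<infinity>s'\<in>states. pmf \<pi> s' * rate lam mu p s' s)
      \<longleftrightarrow> pmf (bind_pmf \<pi> K) s = pmf \<pi> s" if "s \<in> states" for s
  proof -
    have "pmf \<pi> s * ((lam + mu) - (if s = (0, 0) then mu else 0))
        = (lam + mu) * pmf \<pi> s - (if s = (0, 0) then mu * pmf \<pi> s else 0)"
      by (simp add: algebra_simps)
    then show ?thesis using L unfolding balance_in[OF True] balance_out[OF that] by auto
  qed
  then have "stationary_distribution lam mu p \<pi> \<longleftrightarrow> (\<forall>s\<in>states. pmf (bind_pmf \<pi> K) s = pmf \<pi> s)"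
    unfolding stationary_distribution_def using True by auto
  moreover have "pmf (bind_pmf \<pi> K) s = pmf \<pi> s" if "s \<notin> states" for s
  proof -
    have "s \<notin> set_pmf \<pi>" "s \<notin> set_pmf (bind_pmf \<pi> K)"
      using that True set_pmf_step by (auto dest!: subsetD[OF True])
    then show ?thesis by (metis set_pmf_iff)
  qed
  ultimately show ?thesis using True by (auto intro!: pmf_eqI)
qed (simp add: stationary_distribution_def)


section \<open>The total number of customers, and uniqueness of the stationary law\<close>

definition num_customers :: "state \<Rightarrow> nat" where "num_customers s = fst s + snd s"

text \<open>The uniformised M/M/1 queue. Truncated subtraction keeps it at 0 on a service, matching
  the self-loop of the empty polling system.\<close>

definition birth_death :: "nat \<Rightarrow> nat pmf" where
  "birth_death n = map_pmf (\<lambda>a. if a then n + 1 else n - 1) (bernoulli_pmf (lam / (lam + mu)))"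

lemma num_customers_moves:
  "num_customers (join_busy s) = num_customers s + 1"
  "num_customers (join_idle s) = num_customers s + 1"
  "s \<in> states \<Longrightarrow> num_customers (serve s) = num_customers s - 1"
  by (auto simp: num_customers_def states_def join_busy_def join_idle_def serve_def
      switch_if_empty_def split: prod.splits)

text \<open>The chain is lumpable: the law of the new total depends on the old total only. This is
  where the policy \<open>p\<close> drops out.\<close>

lemma map_num_customers_step:
  assumes "s \<in> states"
  shows "map_pmf num_customers (K s) = birth_death (num_customers s)"
proof -
  have "map_pmf num_customers (K s) = bind_pmf (bernoulli_pmf (lam / (lam + mu)))
       (\<lambda>a. if a then map_pmf (\<lambda>b. num_customers s + 1) (bernoulli_pmf p)
            else return_pmf (num_customers s - 1))"
    unfolding step_pmf_def map_bind_pmf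
    using assms by (intro bind_pmf_cong refl)
       (simp add: pmf.map_comp o_def if_distrib[of num_customers] num_customers_moves cong: if_cong)
  also have "\<dots> = birth_death (num_customers s)"
    by (auto simp: birth_death_def map_pmf_def if_distrib cong: if_cong)
  finally show ?thesis .
qed

lemma pmf_birth_death:
  "(lam + mu) * pmf (birth_death n) k = lam * indicator {n + 1} k + mu * indicator {n - 1} k"
proof -
  have "ennreal (pmf (birth_death n) k) = (\<integral>\<^sup>+ y. indicator {k} y \<partial>measure_pmf (birth_death n))"
    by (simp add: emeasure_pmf_single)
  also have "\<dots> = ennreal ((lam * indicator {n + 1} k + mu * indicator {n - 1} k) / (lam + mu))"
    unfolding birth_death_def using lam_ratio lam_pos mu_pos
    by (auto simp: indicator_def add_divide_distrib simp flip: ennreal_plus)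
  finally show ?thesis using lam_pos mu_pos by (subst (asm) ennreal_inj) (auto simp: field_simps)
qed

text \<open>Induction turns the second-order balance equations into balance across the cut between
  \<open>k\<close> and \<open>Suc k\<close>. The masses are then geometric, and total mass one fixes
  the mass at 0.\<close>

lemma birth_death_invariant:
  assumes "bind_pmf \<eta> birth_death = \<eta>"
  shows "\<eta> = geometric_pmf (1 - lam / mu)"
proof -
  have int: "integrable (measure_pmf \<eta>) (indicator {m} :: nat \<Rightarrow> real)" for m
    by (intro measure_pmf.integrable_const_bound[of _ 1]) (auto simp: indicator_def)
  have bal: "(lam + mu) * pmf \<eta> k = measure_pmf.expectation \<eta> (\<lambda>n. (lam + mu) * pmf (birth_death n) k)" for k
    by (subst assms[symmetric]) (simp add: pmf_bind)
  have "(\<lambda>n. (lam + mu) * pmf (birth_death n) 0) = (\<lambda>n. mu * indicator {0} n + mu * indicator {1} n)"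
    by (auto simp: pmf_birth_death indicator_def)
  from bal[of 0, unfolded this] have b0: "lam * pmf \<eta> 0 = mu * pmf \<eta> 1"
    by (simp add: int measure_pmf_single algebra_simps)
  have bS: "(lam + mu) * pmf \<eta> (Suc k) = lam * pmf \<eta> k + mu * pmf \<eta> (Suc (Suc k))" for k
  proof -
    have "(\<lambda>n. (lam + mu) * pmf (birth_death n) (Suc k))
        = (\<lambda>n. lam * indicator {k} n + mu * indicator {Suc (Suc k)} n)"
      unfolding pmf_birth_death by (intro ext) (auto simp: indicator_def of_bool_def)
    from bal[of "Suc k", unfolded this] show ?thesis by (simp add: int measure_pmf_single)
  qed
  have cut: "lam * pmf \<eta> k = mu * pmf \<eta> (Suc k)" for k
  proof (induction k)
    case (Suc k) then show ?case using bS[of k] by (simp add: algebra_simps)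
  qed (use b0 in simp)
  define r where "r = lam / mu"
  have r: "0 < r" "r < 1" using lam_pos lam_less by (auto simp: r_def)
  have geo: "pmf \<eta> k = r ^ k * pmf \<eta> 0" for k
  proof (induction k)
    case (Suc k)
    have "pmf \<eta> (Suc k) = r * pmf \<eta> k" using cut[of k] mu_pos by (simp add: r_def field_simps)
    then show ?case using Suc by simp
  qed simp
  have "(\<lambda>k. r ^ k * pmf \<eta> 0) sums (1 / (1 - r) * pmf \<eta> 0)"
    using r by (intro sums_mult2 geometric_sums) auto
  moreover have "pmf \<eta> sums 1"
  proof -
    have "(\<integral>\<^sup>+ k. pmf \<eta> k \<partial>count_space UNIV) = 1" by (simp add: nn_integral_pmf)
    then have "(\<Sum>k. ennreal (pmf \<eta> k)) = 1" by (simp add: nn_integral_count_space_nat)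
    then have "(\<lambda>k. ennreal (pmf \<eta> k)) sums ennreal 1"
      by (metis ennreal_1 summableI summable_sums)
    then show ?thesis by (subst (asm) sums_ennreal) auto
  qed
  ultimately have "1 / (1 - r) * pmf \<eta> 0 = 1" using geo sums_unique2 by (metis (no_types, lifting) sums_cong)
  then have "pmf \<eta> 0 = 1 - r" using r by (simp add: field_simps)
  then have "pmf \<eta> k = pmf (geometric_pmf (1 - r)) k" for k
    using r geo[of k] by (subst pmf_geometric) auto
  then show ?thesis by (auto intro!: pmf_eqI simp: r_def)
qed

lemma map_num_customers_invariant:
  assumes "bind_pmf \<pi> K = \<pi>" "set_pmf \<pi> \<subseteq> states"
  shows "map_pmf num_customers \<pi> = geometric_pmf (1 - lam / mu)"
proof (rule birth_death_invariant)
  have "bind_pmf (map_pmf num_customers \<pi>) birth_death = bind_pmf \<pi> (\<lambda>s. map_pmf num_customers (K s))"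
    unfolding bind_map_pmf using assms by (intro bind_pmf_cong refl) (auto simp: map_num_customers_step)
  also have "\<dots> = map_pmf num_customers \<pi>" using assms by (simp flip: map_bind_pmf)
  finally show "bind_pmf (map_pmf num_customers \<pi>) birth_death = map_pmf num_customers \<pi>" .
qed

text \<open>\<open>(0, 0)\<close> is the only state with total 0, so its mass can be read off the
  geometric law. It is the reference state for uniqueness.\<close>

lemma pmf_empty:
  assumes "bind_pmf \<pi> K = \<pi>" "set_pmf \<pi> \<subseteq> states"
  shows "pmf \<pi> (0, 0) = 1 - lam / mu"
proof -
  have "pmf (map_pmf num_customers \<pi>) 0 = pmf \<pi> (0, 0)"
    by (subst pmf_map, subst measure_pmf_single[symmetric])
       (auto intro!: arg_cong2[where f=measure] simp: num_customers_def)
  then show ?thesis using lam_pos mu_pos lam_less by (simp add: map_num_customers_invariant[OF assms])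
qed

lemma stationary_unique:
  "stationary_distribution lam mu p \<pi>1 \<Longrightarrow> stationary_distribution lam mu p \<pi>2 \<Longrightarrow> \<pi>1 = \<pi>2"
  unfolding stationary_iff_invariant
  by (rule invariant_pmf_unique[of K states "(0, 0)" "1 - lam / mu"])
     (use pmf_empty mu_pos lam_less in auto)

section \<open>Existence of the stationary law\<close>

text \<open>
  The occupation measure of an excursion from the empty state; the total number of
  customers is a Lyapunov function showing that it is finite.
\<close>

primrec excursion :: "nat \<Rightarrow> state \<Rightarrow> ennreal" where
  "excursion 0 s = indicator {(0, 0)} s"
| "excursion (Suc n) s = (if s = (0, 0) then 0 else push K (excursion n) s)"

declare excursion.simps(2) [simp del]

lemma excursion_outside: "s \<notin> states \<Longrightarrow> excursion n s = 0"
proof (induction n arbitrary: s)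
  case 0 then show ?case by (auto simp: states_def indicator_def split: if_splits)
next
  case (Suc n)
  have "excursion n x * ennreal (pmf (K x) s) = 0" for x
    using Suc set_pmf_step[of x] by (cases "x \<in> states") (auto simp: set_pmf_iff)
  then have "push K (excursion n) s = 0" unfolding push_def by (simp only: nn_integral_const) simp
  then show ?case by (simp add: excursion.simps)
qed

definition level :: "nat \<Rightarrow> ennreal" where
  "level n = (\<integral>\<^sup>+ s. excursion n s * ennreal (real (num_customers s)) \<partial>count_space UNIV)"

text \<open>Killing the excursion at \<open>(0, 0)\<close> is invisible here, since the number of
  customers vanishes there; the killed step can be replaced by the full kernel.\<close>

lemma level_Suc: "level (Suc n) = (\<integral>\<^sup>+ s. excursion n s * (\<integral>\<^sup>+ x. ennreal (real (num_customers x)) \<partial>measure_pmf (K s)) \<partial>count_space UNIV)"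
proof -
  have "level (Suc n) = (\<integral>\<^sup>+ x. push K (excursion n) x * ennreal (real (num_customers x)) \<partial>count_space UNIV)"
    unfolding level_def by (intro nn_integral_cong) (auto simp: num_customers_def excursion.simps)
  then show ?thesis by (simp add: nn_integral_push)
qed

lemma mean_num_customers_step:
  assumes "s \<in> states"
  shows "(\<integral>\<^sup>+ x. ennreal (real (num_customers x)) \<partial>measure_pmf (K s))
    = ennreal ((lam * (real (num_customers s) + 1) + mu * real (num_customers s - 1)) / (lam + mu))"
proof -
  have "(\<integral>\<^sup>+ x. ennreal (real (num_customers x)) \<partial>measure_pmf (K s)) = (\<integral>\<^sup>+ n. ennreal (real n) \<partial>measure_pmf (birth_death (num_customers s)))"
    by (simp flip: map_num_customers_step[OF assms])
  also have "\<dots> = ennreal ((lam * (real (num_customers s) + 1) + mu * real (num_customers s - 1)) / (lam + mu))"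
  proof -
    have "(\<integral>\<^sup>+ n. ennreal (real n) \<partial>measure_pmf (birth_death (num_customers s)))
      = ennreal (real (num_customers s + 1)) * ennreal (lam / (lam + mu))
      + ennreal (real (num_customers s - 1)) * ennreal (mu / (lam + mu))"
      unfolding birth_death_def using lam_ratio by simp
    also have "\<dots> = ennreal ((real (num_customers s + 1)) * (lam / (lam + mu))
       + real (num_customers s - 1) * (mu / (lam + mu)))"
      using lam_pos mu_pos by (simp del: of_nat_add flip: ennreal_plus ennreal_mult)
    also have "(real (num_customers s + 1)) * (lam / (lam + mu)) + real (num_customers s - 1) * (mu / (lam + mu))
      = (lam * (real (num_customers s) + 1) + mu * real (num_customers s - 1)) / (lam + mu)"
      by (simp add: add_divide_distrib mult.commute)
    finally show ?thesis .
  qed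
  finally show ?thesis .
qed

lemma level_1: "level 1 \<le> 1"
proof -
  have "num_customers (0, 0) = 0" "(0, 0) \<in> states" by (auto simp: num_customers_def states_def)
  then have mean_empty: "(\<integral>\<^sup>+ x. ennreal (real (num_customers x)) \<partial>measure_pmf (K (0, 0))) = ennreal (lam / (lam + mu))"
    by (simp add: mean_num_customers_step)
  have "level 1 = (\<integral>\<^sup>+ s. ennreal (lam / (lam + mu)) * indicator {(0, 0) :: state} s \<partial>count_space UNIV)"
    unfolding One_nat_def level_Suc
    by (intro nn_integral_cong) (auto simp: indicator_def mean_empty)
  also have "\<dots> \<le> 1" using lam_ratio by (simp add: nn_integral_cmult_indicator)
  finally show ?thesis .
qed

text \<open>In a nonempty state one step changes the mean total by
  \<open>(lam - mu) / (lam + mu)\<close>. Every step that the excursion survives therefore uses up a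
  fixed share of its level. The empty starting state drifts upwards, so the count begins at
  \<open>Suc n\<close> and \<open>level_1\<close> supplies the initial level.\<close>

lemma level_drift:
  "level (Suc (Suc n)) + ennreal ((mu - lam) / (lam + mu)) * (\<integral>\<^sup>+ s. excursion (Suc n) s \<partial>count_space UNIV)
   \<le> level (Suc n)"
proof -
  have "level (Suc (Suc n)) + ennreal ((mu - lam) / (lam + mu)) * (\<integral>\<^sup>+ s. excursion (Suc n) s \<partial>count_space UNIV)
    = (\<integral>\<^sup>+ s. excursion (Suc n) s * (\<integral>\<^sup>+ x. ennreal (real (num_customers x)) \<partial>measure_pmf (K s))
           + ennreal ((mu - lam) / (lam + mu)) * excursion (Suc n) s \<partial>count_space UNIV)"
    unfolding level_Suc[of "Suc n"] by (subst nn_integral_add) (auto simp: nn_integral_cmult)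
  also have "\<dots> = level (Suc n)" unfolding level_def
  proof (intro nn_integral_cong)
    fix s :: state
    show "excursion (Suc n) s * (\<integral>\<^sup>+ x. ennreal (real (num_customers x)) \<partial>measure_pmf (K s))
       + ennreal ((mu - lam) / (lam + mu)) * excursion (Suc n) s = excursion (Suc n) s * ennreal (real (num_customers s))"
    proof (cases "s \<in> states \<and> s \<noteq> (0, 0)")
      case True
      then have t: "num_customers s \<ge> 1" by (auto simp: states_def num_customers_def)
      have "(\<integral>\<^sup>+ x. ennreal (real (num_customers x)) \<partial>measure_pmf (K s)) + ennreal ((mu - lam) / (lam + mu))
          = ennreal (real (num_customers s))"
        using True t lam_pos lam_less
      proof -
        define N where "N = real (num_customers s)"
        have N: "N \<ge> 1" "real (num_customers s - 1) = N - 1" using t by (auto simp: N_def of_nat_diff)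
        have "(lam * (N + 1) + mu * (N - 1)) / (lam + mu) + (mu - lam) / (lam + mu) = N"
          unfolding add_divide_distrib[symmetric] using lam_pos mu_pos
          by (simp add: divide_eq_eq algebra_simps)
        moreover have "0 \<le> (lam * (N + 1) + mu * (N - 1)) / (lam + mu)" "0 \<le> (mu - lam) / (lam + mu)"
          using lam_pos lam_less mu_pos N(1) by auto
        ultimately show ?thesis
          using True by (simp add: mean_num_customers_step N(2)[unfolded One_nat_def] flip: N_def ennreal_plus)
      qed
      then show ?thesis by (metis distrib_left mult.commute)
    next
      case False
      then have "excursion (Suc n) s = 0"
        using excursion_outside[of s "Suc n"] by (auto simp: excursion.simps)
      then show ?thesis by simp
    qed
  qed
  finally show ?thesis by simp
qed

definition occupation :: "state \<Rightarrow> ennreal" where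
  "occupation s = (\<Sum>n. excursion n s)"

lemma occupation_mass:
  "(\<integral>\<^sup>+ s. occupation s \<partial>count_space UNIV) \<noteq> 0" "(\<integral>\<^sup>+ s. occupation s \<partial>count_space UNIV) < \<infinity>"
proof -
  let ?m = "\<lambda>n. \<integral>\<^sup>+ s. excursion n s \<partial>count_space UNIV"
  define e where "e = ennreal ((mu - lam) / (lam + mu))"
  have e: "e \<noteq> 0" using lam_pos lam_less by (auto simp: e_def ennreal_eq_0_iff field_simps)
  have m0: "?m 0 = 1" by simp
  have tot: "(\<integral>\<^sup>+ s. occupation s \<partial>count_space UNIV) = (\<Sum>n. ?m n)"
    unfolding occupation_def by (rule nn_integral_suminf) simp
  \<comment> \<open>Keeping the level that is still available on the left lets the drift inequality
    telescope by addition alone, without subtraction in \<open>ennreal\<close>.\<close>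
  have part: "(\<Sum>n<k. e * ?m (Suc n)) + level (Suc k) \<le> 1" for k
  proof (induction k)
    case 0 then show ?case using level_1 by simp
  next
    case (Suc k)
    have "(\<Sum>n<Suc k. e * ?m (Suc n)) + level (Suc (Suc k))
        = (\<Sum>n<k. e * ?m (Suc n)) + (level (Suc (Suc k)) + e * ?m (Suc k))" by (simp add: ac_simps)
    also have "\<dots> \<le> (\<Sum>n<k. e * ?m (Suc n)) + level (Suc k)"
      using level_drift[of k] by (intro add_left_mono) (simp add: e_def)
    finally show ?case using Suc.IH by (rule order_trans)
  qed
  have "(\<Sum>n. e * ?m (Suc n)) \<le> 1"
  proof (intro suminf_le_const)
    show "(\<Sum>n<k. e * ?m (Suc n)) \<le> 1" for k
      using part[of k] by (metis add.right_neutral add_left_mono order_trans zero_le)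
  qed simp
  then have "e * (\<Sum>n. ?m (Suc n)) \<le> 1" by simp
  then have "(\<Sum>n. ?m (Suc n)) < \<infinity>" using e
    by (metis ennreal_mult_eq_top_iff ennreal_one_neq_top infinity_ennreal_def less_top top_unique)
  moreover have "(\<Sum>n. ?m n) = 1 + (\<Sum>n. ?m (Suc n))"
    using suminf_offset[of ?m 1] m0 by simp
  ultimately show "(\<integral>\<^sup>+ s. occupation s \<partial>count_space UNIV) < \<infinity>"
    "(\<integral>\<^sup>+ s. occupation s \<partial>count_space UNIV) \<noteq> 0"
    by (auto simp: tot simp del: excursion.simps)
qed

text \<open>Away from the empty state, pushing shifts the series by one index. At the empty state
  the claim says that the excursion returns with probability one; it is deduced from conservation of
  the total mass, where the finite mass of all other states cancels.\<close>

lemma push_occupation: "push K occupation s = occupation s"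
proof -
  have pe: "push K occupation s = (\<Sum>n. push K (excursion n) s)" for s
    unfolding push_def occupation_def
    by (subst nn_integral_suminf[symmetric]) (auto simp: ennreal_suminf_multc)
  have off: "push K occupation s = occupation s" if "s \<noteq> (0, 0)" for s
    using that suminf_offset[of "\<lambda>n. excursion n s" 1] by (simp add: pe occupation_def excursion.simps)
  have split: "(\<integral>\<^sup>+ s. f s \<partial>count_space UNIV) = f (0, 0) + (\<integral>\<^sup>+ s. f s * indicator (- {(0, 0)}) s \<partial>count_space UNIV)"
    for f :: "state \<Rightarrow> ennreal"
  proof -
    have "(\<integral>\<^sup>+ s. f s \<partial>count_space UNIV) = (\<integral>\<^sup>+ s. f s * indicator {(0, 0)} s + f s * indicator (- {(0, 0)}) s \<partial>count_space UNIV)"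
      by (intro nn_integral_cong) (auto simp: indicator_def)
    then show ?thesis by (simp add: nn_integral_add)
  qed
  have eq: "(\<integral>\<^sup>+ s. push K occupation s * indicator (- {(0, 0)}) s \<partial>count_space UNIV)
    = (\<integral>\<^sup>+ s. occupation s * indicator (- {(0, 0)}) s \<partial>count_space UNIV)" (is "_ = ?R")
    by (intro nn_integral_cong) (auto simp: indicator_def off)
  have "?R \<le> (\<integral>\<^sup>+ s. occupation s \<partial>count_space UNIV)"
    by (intro nn_integral_mono) (auto simp: indicator_def)
  then have "?R \<noteq> \<infinity>" using occupation_mass(2) by (auto simp: top_unique)
  moreover have "push K occupation (0, 0) + ?R = occupation (0, 0) + ?R"
    using nn_integral_push_1[of K occupation] split[of "push K occupation"] split[of occupation] eq by simp
  then have "?R + push K occupation (0, 0) = ?R + occupation (0, 0)" by (simp only: add.commute)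
  ultimately have "push K occupation (0, 0) = occupation (0, 0)"
    by (simp add: ennreal_add_left_cancel)
  then show ?thesis using off by (cases "s = (0, 0)") auto
qed

lemma stationary_exists: "\<exists>\<pi>. stationary_distribution lam mu p \<pi>"
proof -
  obtain \<pi> where \<pi>: "bind_pmf \<pi> K = \<pi>"
    "\<And>s. ennreal (pmf \<pi> s) = occupation s / (\<integral>\<^sup>+ s. occupation s \<partial>count_space UNIV)"
    by (rule normalise_invariant[of K occupation, OF push_occupation refl]) (use occupation_mass in auto)
  have "pmf \<pi> s = 0" if "s \<notin> states" for s
    using \<pi>(2)[of s] that by (simp add: occupation_def excursion_outside)
  then have "set_pmf \<pi> \<subseteq> states" by (metis set_pmf_iff subsetI)
  with \<pi>(1) show ?thesis by (auto simp: stationary_iff_invariant)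
qed

lemma stationary_steady_state: "stationary_distribution lam mu p (steady_state lam mu p)"
  unfolding steady_state_def using stationary_exists stationary_unique by (metis theI')

abbreviation "\<pi> \<equiv> steady_state lam mu p"

lemma steady_state_props: "bind_pmf \<pi> K = \<pi>" "set_pmf \<pi> \<subseteq> states"
  using stationary_steady_state by (auto simp: stationary_iff_invariant)

end

section \<open>Moments and mean queue lengths\<close>

lemma summable_square_geometric:
  fixes r :: real
  assumes "0 \<le> r" "r < 1"
  shows "summable (\<lambda>n. real n ^ 2 * r ^ n)"
proof -
  have 0: "summable (\<lambda>n. 1 * x ^ n)" if "norm x < 1" for x :: real
    using that by (simp add: summable_geometric)
  have 1: "summable (\<lambda>n. diffs (\<lambda>_. 1) n * x ^ n)" if "norm x < 1" for x :: real
    using termdiff_converges[of x 1 "\<lambda>_. 1", OF that 0] by simp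
  \<comment> \<open>Differentiating the geometric series twice gives the coefficients
    \<open>(n + 1) * (n + 2)\<close>, which dominate \<open>n ^ 2\<close>.\<close>
  have 2: "summable (\<lambda>n. diffs (diffs (\<lambda>_. 1)) n * r ^ n)"
    by (rule termdiff_converges[of r 1, OF _ 1]) (use assms in auto)
  show ?thesis
    by (rule summable_comparison_test'[OF 2])
       (use assms in \<open>auto simp: diffs_def power2_eq_square intro!: mult_mono mult_right_mono\<close>)
qed

context polling begin

text \<open>Second moments enter because the mean product of the two queue lengths must be finite to
  cancel from its own balance equation.\<close>

lemma integrable_square_num_customers: "integrable (measure_pmf \<pi>) (\<lambda>s. real (num_customers s) ^ 2)"
proof -
  define r where "r = lam / mu"
  have r: "0 < r" "r < 1" using lam_pos lam_less by (auto simp: r_def)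
  have "summable (\<lambda>n. pmf (geometric_pmf (1 - r)) n * real n ^ 2)"
    using summable_mult[OF summable_square_geometric[of r], of "1 - r"] r
    by (simp add: mult_ac)
  then have "integrable (count_space UNIV) (\<lambda>n. pmf (geometric_pmf (1 - r)) n * real n ^ 2)"
    by (subst integrable_count_space_nat_iff) simp
  then have "integrable (measure_pmf (geometric_pmf (1 - r))) (\<lambda>n. real n ^ 2)"
    unfolding measure_pmf_eq_density by (subst integrable_density) auto
  then show ?thesis
    unfolding r_def map_num_customers_invariant[OF steady_state_props, symmetric] by simp
qed

lemma integrable_steady_state:
  "integrable (measure_pmf \<pi>) (\<lambda>s. real (fst s))"
  "integrable (measure_pmf \<pi>) (\<lambda>s. real (snd s))"
  "integrable (measure_pmf \<pi>) (\<lambda>s. real (fst s * snd s))"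
proof -
  have le: "real (fst s) \<le> real (num_customers s) ^ 2" "real (snd s) \<le> real (num_customers s) ^ 2"
    "real (fst s * snd s) \<le> real (num_customers s) ^ 2" for s
  proof -
    have "n \<le> n ^ 2" for n :: nat by (simp add: power2_nat_le_imp_le power2_eq_square)
    from this[of "fst s + snd s"] have "fst s + snd s \<le> (fst s + snd s) ^ 2" .
    moreover have "fst s * snd s \<le> (fst s + snd s) ^ 2" by (simp add: power2_eq_square algebra_simps)
    ultimately show "real (fst s) \<le> real (num_customers s) ^ 2" "real (snd s) \<le> real (num_customers s) ^ 2"
      "real (fst s * snd s) \<le> real (num_customers s) ^ 2"
      unfolding num_customers_def of_nat_power[symmetric] of_nat_le_iff by linarith+
  qed
  show "integrable (measure_pmf \<pi>) (\<lambda>s. real (fst s))" "integrable (measure_pmf \<pi>) (\<lambda>s. real (snd s))"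
    "integrable (measure_pmf \<pi>) (\<lambda>s. real (fst s * snd s))"
    using le by (auto intro!: Bochner_Integration.integrable_bound[OF integrable_square_num_customers] simp del: of_nat_mult)
qed

definition mean_busy :: real where
  "mean_busy = measure_pmf.expectation \<pi> (\<lambda>s. real (fst s))"

definition mean_idle :: real where
  "mean_idle = measure_pmf.expectation \<pi> (\<lambda>s. real (snd s))"

lemma mean_busy_plus_idle: "mean_busy + mean_idle = lam / (mu - lam)"
proof -
  have "mean_busy + mean_idle = measure_pmf.expectation \<pi> (\<lambda>s. real (num_customers s))"
    by (simp add: mean_busy_def mean_idle_def num_customers_def integrable_steady_state)
  also have "\<dots> = measure_pmf.expectation (map_pmf num_customers \<pi>) real" by simp
  also have "\<dots> = lam / mu / (1 - lam / mu)"
    unfolding map_num_customers_invariant[OF steady_state_props]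
    using lam_pos lam_less by (subst expectation_geometric_pmf) (auto simp: field_simps)
  also have "\<dots> = lam / (mu - lam)" using lam_pos lam_less by (simp add: field_simps)
  finally show ?thesis .
qed

text \<open>The product is a good test function because it does not notice the boundary: when a
  service empties the busy queue, or a customer joins the idle queue of the empty system, the new
  product is 0, and so is the value of the interior formula. Hence the drift is linear in
  \<open>i\<close> and \<open>j\<close> everywhere.\<close>

lemma mean_product_step:
  assumes "(i, j) \<in> states"
  shows "(\<integral>\<^sup>+ x. ennreal (real (fst x * snd x)) \<partial>measure_pmf (K (i, j)))
    = ennreal (real (i * j) + (lam * p * j + lam * (1 - p) * i - mu * j) / (lam + mu))"
proof -
  have jb: "real (fst (join_busy (i, j)) * snd (join_busy (i, j))) = (real i + 1) * j"
    by (simp add: join_busy_def algebra_simps)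
  have ji: "real (fst (join_idle (i, j)) * snd (join_idle (i, j))) = real i * (real j + 1)"
    using assms by (auto simp: join_idle_def switch_if_empty_def states_def algebra_simps)
  have sv: "real (fst (serve (i, j)) * snd (serve (i, j))) = real i * j - j" "real i * j - j \<ge> 0"
    using assms by (cases i; auto simp: serve_def switch_if_empty_def states_def algebra_simps)+
  have "(\<integral>\<^sup>+ x. ennreal (real (fst x * snd x)) \<partial>measure_pmf (K (i, j)))
    = ennreal (lam * p / (lam + mu) * ((real i + 1) * j) + lam * (1 - p) / (lam + mu) * (real i * (real j + 1))
        + mu / (lam + mu) * (real i * j - j))"
    unfolding nn_integral_step jb ji sv(1) using lam_pos mu_pos p_nonneg p_le_1 sv(2)
    by (simp flip: ennreal_plus ennreal_mult)
  also have "lam * p / (lam + mu) * ((real i + 1) * j) + lam * (1 - p) / (lam + mu) * (real i * (real j + 1))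
        + mu / (lam + mu) * (real i * j - j)
      = (lam + mu) * (real i * j) / (lam + mu) + (lam * p * j + lam * (1 - p) * i - mu * j) / (lam + mu)"
    unfolding add_divide_distrib[symmetric] times_divide_eq_left by (simp add: algebra_simps)
  finally show ?thesis using lam_pos mu_pos by simp
qed

text \<open>
  Balance of the product of the two queue lengths. By Little's law it says that the customers in
  the idle queue wait for an average time \<open>mean_busy / (mu - lam * p)\<close>.
\<close>

lemma mean_idle_eq: "(mu - lam * p) * mean_idle = lam * (1 - p) * mean_busy"
proof -
  define g where "g s = real (fst s * snd s) + (lam * p * snd s + lam * (1 - p) * fst s - mu * snd s) / (lam + mu)"
    for s :: state
  have gi: "integrable (measure_pmf \<pi>) g" unfolding g_def
    by (intro Bochner_Integration.integrable_add Bochner_Integration.integrable_divide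
          Bochner_Integration.integrable_diff integrable_mult_right integrable_steady_state)
  have step: "(\<integral>\<^sup>+ x. ennreal (real (fst x * snd x)) \<partial>measure_pmf (K s)) = ennreal (g s)" if "s \<in> set_pmf \<pi>" for s
    using mean_product_step[of "fst s" "snd s"] steady_state_props(2) that by (auto simp: g_def)
  \<comment> \<open>Nonnegativity on the support allows the identity of nonnegative integrals to be
    read as one of real expectations, from which the product can be subtracted.\<close>
  have g0: "g s \<ge> 0" if s: "s \<in> set_pmf \<pi>" for s
  proof -
    obtain i j where s': "s = (i, j)" by (cases s)
    have ij: "(i, j) \<in> states" using s s' steady_state_props(2) by auto
    have "real i * j - j \<ge> 0" using ij by (cases i) (auto simp: states_def algebra_simps)
    then have "0 \<le> (lam * p * ((real i + 1) * j) + lam * (1 - p) * (real i * (real j + 1)) + mu * (real i * j - j)) / (lam + mu)"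
      using lam_pos mu_pos p_nonneg p_le_1 by simp
    also have "\<dots> = g s" using lam_pos mu_pos unfolding g_def s'
      by (simp add: eq_divide_eq divide_eq_eq add_divide_eq_iff algebra_simps)
    finally show ?thesis .
  qed
  have "(\<integral>\<^sup>+ s. ennreal (real (fst s * snd s)) \<partial>measure_pmf \<pi>)
      = (\<integral>\<^sup>+ s. ennreal (real (fst s * snd s)) \<partial>measure_pmf (bind_pmf \<pi> K))"
    by (simp only: steady_state_props(1))
  also have "\<dots> = (\<integral>\<^sup>+ s. ennreal (g s) \<partial>measure_pmf \<pi>)"
    unfolding nn_integral_bind_pmf by (intro nn_integral_cong_AE AE_pmfI step)
  finally have "measure_pmf.expectation \<pi> (\<lambda>s. real (fst s * snd s)) = measure_pmf.expectation \<pi> g"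
    using g0 by (subst (1 2) integral_eq_nn_integral) (auto intro!: AE_pmfI)
  also have "\<dots> = measure_pmf.expectation \<pi> (\<lambda>s. real (fst s * snd s))
     + (lam * p * mean_idle + lam * (1 - p) * mean_busy - mu * mean_idle) / (lam + mu)"
    unfolding g_def mean_busy_def mean_idle_def
    using integrable_steady_state
    by (simp add: Bochner_Integration.integral_add Bochner_Integration.integral_diff del: of_nat_mult)
  finally show ?thesis using lam_pos mu_pos by (simp add: algebra_simps)
qed

lemma mean_queue_lengths:
  "mean_busy = lam / (mu - lam) * (mu - lam * p) / (mu + lam - 2 * lam * p)"
  "mean_idle = lam / (mu - lam) * (lam * (1 - p)) / (mu + lam - 2 * lam * p)"
proof -
  have "lam * p \<le> lam" using lam_pos p_le_1 by simp
  then have pos: "mu - lam * p > 0" "mu + lam - 2 * lam * p > 0" using lam_less by (auto simp: algebra_simps)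
  have "mean_busy * (mu + lam - 2 * lam * p) = (mean_busy + mean_idle) * (mu - lam * p)"
    "mean_idle * (mu + lam - 2 * lam * p) = (mean_busy + mean_idle) * (lam * (1 - p))"
    using mean_idle_eq by (auto simp: algebra_simps)
  then show "mean_busy = lam / (mu - lam) * (mu - lam * p) / (mu + lam - 2 * lam * p)"
    "mean_idle = lam / (mu - lam) * (lam * (1 - p)) / (mu + lam - 2 * lam * p)"
    using pos by (simp_all only: mean_busy_plus_idle nonzero_eq_divide_eq[OF less_imp_neq[THEN not_sym]])
qed

end

section \<open>Exponential clocks\<close>

lemma sets_exponential [measurable_cong, simp]: "sets (exponential r) = sets borel"
  by (simp add: exponential_def)

lemma space_exponential [simp]: "space (exponential r) = UNIV"
  by (simp add: exponential_def)

lemma prob_space_exponential: "0 < r \<Longrightarrow> prob_space (exponential r)"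
  unfolding exponential_def by (rule prob_space_exponential_density)

lemma nn_integral_exponential:
  "f \<in> borel_measurable borel \<Longrightarrow>
   (\<integral>\<^sup>+ x. f x \<partial>exponential r) = (\<integral>\<^sup>+ x. ennreal (exponential_density r x) * f x \<partial>lborel)"
  unfolding exponential_def by (subst nn_integral_density) auto

lemma AE_exponential_pos: "AE x in exponential r. 0 < x"
proof -
  have "AE x in lborel. x \<noteq> (0::real)" by (rule AE_lborel_singleton)
  then show ?thesis unfolding exponential_def
    by (subst AE_density) (auto simp: exponential_density_def elim!: eventually_mono)
qed

lemma nn_integral_exponential_id:
  assumes "0 < r"
  shows "(\<integral>\<^sup>+ x. ennreal x \<partial>exponential r) = ennreal (1 / r)"
proof -
  have "(\<integral>\<^sup>+ x. ennreal x \<partial>exponential r) = (\<integral>\<^sup>+ x. ennreal (exponential_density r x * x ^ 1) \<partial>lborel)"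
    by (subst nn_integral_exponential)
       (auto intro!: nn_integral_cong simp: exponential_density_def ennreal_mult ennreal_neg assms less_imp_le)
  also have "\<dots> = ennreal (1 / r)"
    using nn_integral_erlang_ith_moment[OF assms, of 0 1] by simp
  finally show ?thesis .
qed

lemma exponential_memoryless:
  assumes r: "0 < r" and a: "0 \<le> a" and h[measurable]: "h \<in> borel_measurable borel"
  shows "(\<integral>\<^sup>+ s. (if a \<le> s then h (s - a) else 0) \<partial>exponential r)
       = ennreal (exp (- r * a)) * (\<integral>\<^sup>+ s. h s \<partial>exponential r)"
proof -
  have "(\<integral>\<^sup>+ s. (if a \<le> s then h (s - a) else 0) \<partial>exponential r)
      = (\<integral>\<^sup>+ s. ennreal (exponential_density r s) * (if a \<le> s then h (s - a) else 0) \<partial>lborel)"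
    by (subst nn_integral_exponential) auto
  also have "\<dots> = (\<integral>\<^sup>+ s. ennreal (exponential_density r (a + s)) * (if 0 \<le> s then h s else 0) \<partial>lborel)"
    by (subst nn_integral_real_affine[where c = 1 and t = a]) (auto intro!: nn_integral_cong)
  also have "\<dots> = (\<integral>\<^sup>+ s. ennreal (exp (- r * a)) * (ennreal (exponential_density r s) * h s) \<partial>lborel)"
    using r a by (intro nn_integral_cong)
      (auto simp: exponential_density_def exp_add[symmetric] algebra_simps mult.assoc[symmetric] simp flip: ennreal_mult)
  also have "\<dots> = ennreal (exp (- r * a)) * (\<integral>\<^sup>+ s. h s \<partial>exponential r)"
    by (simp add: nn_integral_cmult nn_integral_exponential)
  finally show ?thesis .
qed

text \<open>Ties between the two clocks are resolved in favour of the arrival, so one branch of the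
  first-event analysis needs the strict comparison; the difference is a null set.\<close>

lemma exponential_memoryless':
  assumes r: "0 < r" and a: "0 \<le> a" and h[measurable]: "h \<in> borel_measurable borel"
  shows "(\<integral>\<^sup>+ s. (if a < s then h (s - a) else 0) \<partial>exponential r)
       = ennreal (exp (- r * a)) * (\<integral>\<^sup>+ s. h s \<partial>exponential r)"
proof -
  have "AE s in lborel. s \<noteq> a" by (rule AE_lborel_singleton)
  then have "AE s in exponential r. s \<noteq> a"
    unfolding exponential_def by (subst AE_density) (auto elim!: eventually_mono)
  then have "(\<integral>\<^sup>+ s. (if a < s then h (s - a) else 0) \<partial>exponential r)
      = (\<integral>\<^sup>+ s. (if a \<le> s then h (s - a) else 0) \<partial>exponential r)"
    by (intro nn_integral_cong_AE) (auto elim!: eventually_mono)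
  then show ?thesis using exponential_memoryless[OF assms] by simp
qed

text \<open>Competition of two clocks: \<open>exp (- q * s)\<close> is the probability that a clock
  of rate \<open>q\<close> is still silent at time \<open>s\<close>. The right-hand side is the
  probability that the clock of rate \<open>r\<close> rings first, times the law of the
  minimum.\<close>

lemma exponential_tilt:
  assumes "0 < r" "0 \<le> q" and h[measurable]: "h \<in> borel_measurable borel"
  shows "(\<integral>\<^sup>+ s. ennreal (exp (- q * s)) * h s \<partial>exponential r)
       = ennreal (r / (r + q)) * (\<integral>\<^sup>+ s. h s \<partial>exponential (r + q))"
proof -
  have "(\<integral>\<^sup>+ s. ennreal (exp (- q * s)) * h s \<partial>exponential r)
      = (\<integral>\<^sup>+ s. ennreal (exponential_density r s) * (ennreal (exp (- q * s)) * h s) \<partial>lborel)"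
    by (subst nn_integral_exponential) auto
  also have "\<dots> = (\<integral>\<^sup>+ s. ennreal (r / (r + q)) * (ennreal (exponential_density (r + q) s) * h s) \<partial>lborel)"
  proof (intro nn_integral_cong)
    fix s
    have "exponential_density r s * exp (- q * s) = r / (r + q) * exponential_density (r + q) s"
    proof -
      have "exp (- s * r) * exp (- q * s) = exp (- s * (r + q))"
        by (simp add: exp_add[symmetric] algebra_simps)
      moreover have "r + q \<noteq> 0" using assms by simp
      ultimately show ?thesis by (simp add: exponential_density_def)
    qed
    then have "ennreal (exponential_density r s) * ennreal (exp (- q * s))
       = ennreal (r / (r + q)) * ennreal (exponential_density (r + q) s)"
      using assms by (simp flip: ennreal_mult)
    then show "ennreal (exponential_density r s) * (ennreal (exp (- q * s)) * h s)
       = ennreal (r / (r + q)) * (ennreal (exponential_density (r + q) s) * h s)"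
      by (simp add: mult.assoc[symmetric])
  qed
  also have "\<dots> = ennreal (r / (r + q)) * (\<integral>\<^sup>+ s. h s \<partial>exponential (r + q))"
    by (simp add: nn_integral_cmult nn_integral_exponential)
  finally show ?thesis .
qed

lemma nn_integral_PiM_case_nat:
  assumes "prob_space M" and G[measurable]: "G \<in> borel_measurable (\<Pi>\<^sub>M n\<in>(UNIV :: nat set). M)"
  shows "(\<integral>\<^sup>+ X. G X \<partial>(\<Pi>\<^sub>M n\<in>UNIV. M)) = (\<integral>\<^sup>+ x. \<integral>\<^sup>+ X. G (case_nat x X) \<partial>(\<Pi>\<^sub>M n\<in>UNIV. M) \<partial>M)"
proof -
  interpret prob_space M by fact
  interpret sequence_space M ..
  have "sigma_finite_measure S"
    by (intro prob_space_imp_sigma_finite prob_space_PiM prob_space_axioms)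
  have "(\<integral>\<^sup>+ X. G X \<partial>S) = (\<integral>\<^sup>+ X. G X \<partial>distr (M \<Otimes>\<^sub>M S) S (\<lambda>(s, \<omega>). case_nat s \<omega>))"
    by (simp only: PiM_iter)
  also have "\<dots> = (\<integral>\<^sup>+ z. G (case_nat (fst z) (snd z)) \<partial>(M \<Otimes>\<^sub>M S))"
    by (subst nn_integral_distr) (auto simp: split_beta)
  also have "\<dots> = (\<integral>\<^sup>+ x. \<integral>\<^sup>+ X. G (case_nat x X) \<partial>S \<partial>M)"
    using \<open>sigma_finite_measure S\<close> by (subst sigma_finite_measure.nn_integral_fst[symmetric]) auto
  finally show ?thesis .
qed

abbreviation clocks :: "real \<Rightarrow> (nat \<Rightarrow> real) measure" where
  "clocks r \<equiv> \<Pi>\<^sub>M n\<in>UNIV. exponential r"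

abbreviation sequences :: "'a measure \<Rightarrow> (nat \<Rightarrow> 'a) measure" where
  "sequences M \<equiv> \<Pi>\<^sub>M n\<in>UNIV. M"

definition tail :: "(nat \<Rightarrow> 'a) \<Rightarrow> nat \<Rightarrow> 'a" where
  "tail X n = X (Suc n)"

definition residual :: "real \<Rightarrow> (nat \<Rightarrow> real) \<Rightarrow> nat \<Rightarrow> real" where
  "residual a X = case_nat (X 0 - a) (tail X)"

lemma tail_case_nat [simp]: "tail (case_nat x X) = X"
  by (simp add: tail_def fun_eq_iff)

lemma residual_case_nat [simp]: "residual a (case_nat x X) = case_nat (x - a) X"
  by (simp add: residual_def)

lemma sets_clocks [measurable_cong]: "sets (clocks r) = sets (sequences borel)"
  by (intro sets_PiM_cong) auto

lemma measurable_tail [measurable]: "tail \<in> measurable (sequences M) (sequences M)"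
proof -
  have "(\<lambda>X n. X (Suc n)) \<in> measurable (sequences M) (sequences M)"
    by (rule measurable_PiM_single') (auto simp: space_PiM)
  then show ?thesis by (simp add: tail_def[abs_def])
qed

lemma measurable_residual [measurable (raw)]:
  assumes [measurable]: "f \<in> borel_measurable N" "g \<in> measurable N (sequences borel)"
  shows "(\<lambda>x. residual (f x) (g x)) \<in> measurable N (sequences borel)"
  unfolding residual_def by measurable

lemma AE_clocks: "0 < r \<Longrightarrow> AE X in clocks r. \<forall>k. 0 < X k"
proof -
  assume "0 < r"
  interpret E: prob_space "exponential r" by (rule prob_space_exponential) fact
  interpret P: product_prob_space "\<lambda>_. exponential r" "UNIV :: nat set" ..
  have "AE X in clocks r. 0 < X k" for k
  proof -
    have "AE x in distr (clocks r) (exponential r) (\<lambda>X. X k). 0 < x"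
      unfolding P.PiM_component[OF UNIV_I] by (rule AE_exponential_pos)
    then show ?thesis by (subst (asm) AE_distr_iff) auto
  qed
  then show ?thesis by (simp add: AE_all_countable)
qed

lemma clocks_memoryless:
  assumes r: "0 < r" and a: "0 \<le> a" and h: "h \<in> borel_measurable (sequences borel)"
  shows "(\<integral>\<^sup>+ X. (if a \<le> X 0 then h (residual a X) else 0) \<partial>clocks r)
       = ennreal (exp (- r * a)) * (\<integral>\<^sup>+ X. h X \<partial>clocks r)" (is ?le)
    and "(\<integral>\<^sup>+ X. (if a < X 0 then h (residual a X) else 0) \<partial>clocks r)
       = ennreal (exp (- r * a)) * (\<integral>\<^sup>+ X. h X \<partial>clocks r)" (is ?less)
proof -
  note h[measurable]
  interpret E: prob_space "exponential r" by (rule prob_space_exponential[OF r])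
  interpret S: prob_space "clocks r" by (intro prob_space_PiM E.prob_space_axioms)
  define g where "g x = (\<integral>\<^sup>+ X. h (case_nat x X) \<partial>clocks r)" for x
  have g[measurable]: "g \<in> borel_measurable borel" unfolding g_def by measurable
  have hg: "(\<integral>\<^sup>+ X. h X \<partial>clocks r) = (\<integral>\<^sup>+ x. g x \<partial>exponential r)"
    unfolding g_def by (rule nn_integral_PiM_case_nat[OF E.prob_space_axioms]) measurable
  have "(\<integral>\<^sup>+ X. (if a \<le> X 0 then h (residual a X) else 0) \<partial>clocks r)
     = (\<integral>\<^sup>+ x. \<integral>\<^sup>+ X. (if a \<le> x then h (case_nat (x - a) X) else 0) \<partial>clocks r \<partial>exponential r)"
    by (subst nn_integral_PiM_case_nat[OF E.prob_space_axioms], measurable) (simp cong: if_cong)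
  also have "\<dots> = (\<integral>\<^sup>+ x. (if a \<le> x then g (x - a) else 0) \<partial>exponential r)"
    by (intro nn_integral_cong) (auto simp: g_def)
  finally show ?le using exponential_memoryless[OF r a g] hg by simp
  have "(\<integral>\<^sup>+ X. (if a < X 0 then h (residual a X) else 0) \<partial>clocks r)
     = (\<integral>\<^sup>+ x. \<integral>\<^sup>+ X. (if a < x then h (case_nat (x - a) X) else 0) \<partial>clocks r \<partial>exponential r)"
    by (subst nn_integral_PiM_case_nat[OF E.prob_space_axioms], measurable) (simp cong: if_cong)
  also have "\<dots> = (\<integral>\<^sup>+ x. (if a < x then g (x - a) else 0) \<partial>exponential r)"
    by (intro nn_integral_cong) (auto simp: g_def)
  finally show ?less using exponential_memoryless'[OF r a g] hg by simp
qed

section \<open>The first event after the arrival of the tagged customer\<close>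

abbreviation futures :: "future measure" where
  "futures \<equiv> sequences borel \<Otimes>\<^sub>M (sequences (count_space UNIV) \<Otimes>\<^sub>M sequences borel)"

lemma sequences_in_space [simp]:
  "X \<in> space (sequences borel)" "Y \<in> space (sequences (count_space UNIV))"
  by (auto simp: space_PiM)

text \<open>The driving sequences as seen from the first event: the clock that rang is dropped, the
  other one goes on with its remaining time. Only an arrival consumes a choice.\<close>

definition after_arrival :: "future \<Rightarrow> future" where
  "after_arrival = (\<lambda>(A, B, S). (tail A, tail B, residual (A 0) S))"

definition after_service :: "future \<Rightarrow> future" where
  "after_service = (\<lambda>(A, B, S). (residual (S 0) A, B, tail S))"

lemma measurable_after [measurable]:
  "after_arrival \<in> measurable futures futures" "after_service \<in> measurable futures futures"
  unfolding after_arrival_def after_service_def by measurable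

context polling begin

abbreviation "arrivals \<equiv> clocks lam"
abbreviation "services \<equiv> clocks mu"
abbreviation "choices \<equiv> \<Pi>\<^sub>M n\<in>(UNIV :: nat set). measure_pmf (bernoulli_pmf p)"
abbreviation "F \<equiv> future_measure lam mu p"

lemma sets_choices [measurable_cong]: "sets choices = sets (sequences (count_space UNIV))"
  by (intro sets_PiM_cong) auto

lemma sets_future [measurable_cong]: "sets F = sets futures"
  unfolding future_measure_def
  by (intro sets_pair_measure_cong sets_clocks sets_choices)

lemma prob_space_arrivals: "prob_space arrivals"
  and prob_space_services: "prob_space services"
  and prob_space_choices: "prob_space choices"
  by (intro prob_space_PiM prob_space_exponential lam_pos mu_pos prob_space_measure_pmf)+

lemma prob_space_future: "prob_space F"
  unfolding future_measure_def
  by (intro prob_space_pair prob_space_arrivals prob_space_services prob_space_choices)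

lemma nn_integral_future:
  assumes "f \<in> borel_measurable futures"
  shows "(\<integral>\<^sup>+ \<omega>. f \<omega> \<partial>F) = (\<integral>\<^sup>+ A. \<integral>\<^sup>+ B. \<integral>\<^sup>+ S. f (A, B, S) \<partial>services \<partial>choices \<partial>arrivals)"
proof -
  interpret S: prob_space services by (rule prob_space_services)
  interpret C: prob_space choices by (rule prob_space_choices)
  interpret CS: prob_space "choices \<Otimes>\<^sub>M services"
    by (intro prob_space_pair prob_space_choices prob_space_services)
  note assms[measurable]
  have "(\<integral>\<^sup>+ \<omega>. f \<omega> \<partial>F) = (\<integral>\<^sup>+ A. \<integral>\<^sup>+ \<omega>. f (A, \<omega>) \<partial>(choices \<Otimes>\<^sub>M services) \<partial>arrivals)"
    unfolding future_measure_def by (rule CS.nn_integral_fst[symmetric]) measurable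
  also have "\<dots> = (\<integral>\<^sup>+ A. \<integral>\<^sup>+ B. \<integral>\<^sup>+ S. f (A, B, S) \<partial>services \<partial>choices \<partial>arrivals)"
  proof (intro nn_integral_cong S.nn_integral_fst[symmetric])
    fix A :: "nat \<Rightarrow> real"
    have "(\<lambda>\<omega>. f (A, \<omega>)) \<in> borel_measurable (sequences (count_space UNIV) \<Otimes>\<^sub>M sequences borel)"
      by measurable
    then show "(\<lambda>\<omega>. f (A, \<omega>)) \<in> borel_measurable (choices \<Otimes>\<^sub>M services)"
      by (simp cong: measurable_cong_sets add: sets_choices sets_clocks)
  qed
  finally show ?thesis .
qed

text \<open>Markov property at the first event, in integrated form: given that an arrival comes
  first, the elapsed time, the choice and the remaining future are independent, and the future has
  its original law. The elapsed time has the law of the minimum of the two clocks, whichever of them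
  rang.\<close>

lemma first_event_arrival:
  assumes f[measurable]: "f \<in> borel_measurable (borel \<Otimes>\<^sub>M count_space UNIV \<Otimes>\<^sub>M futures)"
  shows "(\<integral>\<^sup>+ \<omega>. (case \<omega> of (A, B, S) \<Rightarrow> if A 0 \<le> S 0 then f (A 0, B 0, after_arrival \<omega>) else 0) \<partial>F)
    = ennreal (lam / (lam + mu)) *
      (\<integral>\<^sup>+ t. \<integral>\<^sup>+ b. \<integral>\<^sup>+ \<omega>. f (t, b, \<omega>) \<partial>F \<partial>measure_pmf (bernoulli_pmf p) \<partial>exponential (lam + mu))"
proof -
  interpret A: prob_space arrivals by (rule prob_space_arrivals)
  interpret S: prob_space services by (rule prob_space_services)
  interpret C: prob_space choices by (rule prob_space_choices)
  interpret B: prob_space "measure_pmf (bernoulli_pmf p)" by (rule prob_space_measure_pmf)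
  interpret AB: pair_sigma_finite arrivals "measure_pmf (bernoulli_pmf p)" ..
  interpret E: prob_space "exponential lam" by (rule prob_space_exponential[OF lam_pos])
  have [simp]: "(\<lambda>S. f (A 0, B 0, (tail A, tail B, S))) \<in> borel_measurable (sequences borel)" for A B
    by measurable
  have ms: "prob_space (measure_pmf (bernoulli_pmf p))" by (rule prob_space_measure_pmf)
  have pos: "AE A in arrivals. 0 < A 0"
    using AE_clocks[OF lam_pos] by (auto elim: eventually_mono)
  have "(\<integral>\<^sup>+ \<omega>. (case \<omega> of (A, B, S) \<Rightarrow> if A 0 \<le> S 0 then f (A 0, B 0, after_arrival \<omega>) else 0) \<partial>F)
    = (\<integral>\<^sup>+ A. \<integral>\<^sup>+ B. \<integral>\<^sup>+ S. (if A 0 \<le> S 0 then f (A 0, B 0, (tail A, tail B, residual (A 0) S)) else 0)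
        \<partial>services \<partial>choices \<partial>arrivals)"
    by (subst nn_integral_future, measurable) (simp add: after_arrival_def cong: if_cong)
  \<comment> \<open>For a fixed arrival time the service clocks are integrated out; surviving that
    long leaves the factor that later tilts the law of the arrival time.\<close>
  also have "\<dots> = (\<integral>\<^sup>+ A. \<integral>\<^sup>+ B. ennreal (exp (- mu * A 0)) * (\<integral>\<^sup>+ S. f (A 0, B 0, (tail A, tail B, S)) \<partial>services)
        \<partial>choices \<partial>arrivals)"
    by (rule nn_integral_cong_AE, rule AE_mp[OF pos], rule AE_I2, rule impI, intro nn_integral_cong,
        rule clocks_memoryless(1)[OF mu_pos]) (auto intro: less_imp_le)
  also have "\<dots> = (\<integral>\<^sup>+ a. \<integral>\<^sup>+ A. \<integral>\<^sup>+ b. \<integral>\<^sup>+ B. ennreal (exp (- mu * a)) * (\<integral>\<^sup>+ S. f (a, b, (A, B, S)) \<partial>services)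
        \<partial>choices \<partial>measure_pmf (bernoulli_pmf p) \<partial>arrivals \<partial>exponential lam)"
    by (subst nn_integral_PiM_case_nat[OF E.prob_space_axioms], measurable,
        intro nn_integral_cong, subst nn_integral_PiM_case_nat[OF ms]) simp_all
  also have "\<dots> = (\<integral>\<^sup>+ a. \<integral>\<^sup>+ b. \<integral>\<^sup>+ A. \<integral>\<^sup>+ B. ennreal (exp (- mu * a)) * (\<integral>\<^sup>+ S. f (a, b, (A, B, S)) \<partial>services)
        \<partial>choices \<partial>arrivals \<partial>measure_pmf (bernoulli_pmf p) \<partial>exponential lam)"
    by (intro nn_integral_cong AB.Fubini'[symmetric]) measurable
  also have "\<dots> = (\<integral>\<^sup>+ a. ennreal (exp (- mu * a)) * (\<integral>\<^sup>+ b. \<integral>\<^sup>+ \<omega>. f (a, b, \<omega>) \<partial>F \<partial>measure_pmf (bernoulli_pmf p)) \<partial>exponential lam)"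
    by (simp add: nn_integral_cmult nn_integral_future)
  also have "\<dots> = ennreal (lam / (lam + mu)) *
      (\<integral>\<^sup>+ t. \<integral>\<^sup>+ b. \<integral>\<^sup>+ \<omega>. f (t, b, \<omega>) \<partial>F \<partial>measure_pmf (bernoulli_pmf p) \<partial>exponential (lam + mu))"
    by (rule exponential_tilt) (use lam_pos mu_pos in \<open>auto simp: nn_integral_future\<close>)
  finally show ?thesis .
qed

lemma first_event_service:
  assumes g[measurable]: "g \<in> borel_measurable (borel \<Otimes>\<^sub>M futures)"
  shows "(\<integral>\<^sup>+ \<omega>. (case \<omega> of (A, B, S) \<Rightarrow> if S 0 < A 0 then g (S 0, after_service \<omega>) else 0) \<partial>F)
    = ennreal (mu / (lam + mu)) * (\<integral>\<^sup>+ t. \<integral>\<^sup>+ \<omega>. g (t, \<omega>) \<partial>F \<partial>exponential (lam + mu))"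
proof -
  interpret A: prob_space arrivals by (rule prob_space_arrivals)
  interpret S: prob_space services by (rule prob_space_services)
  interpret C: prob_space choices by (rule prob_space_choices)
  interpret AC: pair_sigma_finite arrivals choices ..
  interpret AS: pair_sigma_finite arrivals services ..
  interpret E: prob_space "exponential mu" by (rule prob_space_exponential[OF mu_pos])
  interpret EC: pair_sigma_finite "exponential mu" choices ..
  have pos: "AE S in services. 0 < S 0"
    using AE_clocks[OF mu_pos] by (auto elim: eventually_mono)
  have [simp]: "(\<lambda>A. g (S 0, (A, B, tail S))) \<in> borel_measurable (sequences borel)" for B S
    by measurable
  \<comment> \<open>\<open>nn_integral_future\<close> has the service clocks innermost. Here the
    clock that survives is the arrival clock, so its integral must be moved inside.\<close>
  have swap: "(\<integral>\<^sup>+ A. \<integral>\<^sup>+ B. \<integral>\<^sup>+ S. h A B S \<partial>services \<partial>choices \<partial>arrivals)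
      = (\<integral>\<^sup>+ B. \<integral>\<^sup>+ S. \<integral>\<^sup>+ A. h A B S \<partial>arrivals \<partial>services \<partial>choices)"
    if "(\<lambda>(A, B, S). h A B S) \<in> borel_measurable futures" for h :: "_ \<Rightarrow> _ \<Rightarrow> _ \<Rightarrow> ennreal"
  proof -
    define k where "k = (\<lambda>(A, B, S). h A B S)"
    have k[measurable]: "k \<in> borel_measurable futures" using that by (simp add: k_def)
    have h: "h A B S = k (A, B, S)" for A B S by (simp add: k_def)
    have "(\<integral>\<^sup>+ A. \<integral>\<^sup>+ B. \<integral>\<^sup>+ S. h A B S \<partial>services \<partial>choices \<partial>arrivals)
       = (\<integral>\<^sup>+ B. \<integral>\<^sup>+ A. \<integral>\<^sup>+ S. h A B S \<partial>services \<partial>arrivals \<partial>choices)"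
      unfolding h by (intro AC.Fubini'[symmetric]) measurable
    also have "\<dots> = (\<integral>\<^sup>+ B. \<integral>\<^sup>+ S. \<integral>\<^sup>+ A. h A B S \<partial>arrivals \<partial>services \<partial>choices)"
      unfolding h
    proof (intro nn_integral_cong AS.Fubini'[symmetric])
      fix B :: "nat \<Rightarrow> bool"
      have "(\<lambda>(A, S). k (A, B, S)) \<in> borel_measurable (sequences borel \<Otimes>\<^sub>M sequences borel)"
        by measurable
      then show "(\<lambda>(A, S). k (A, B, S)) \<in> borel_measurable (arrivals \<Otimes>\<^sub>M services)"
        by (simp cong: measurable_cong_sets sets_pair_measure_cong add: sets_clocks)
    qed
    finally show ?thesis .
  qed
  have "(\<integral>\<^sup>+ \<omega>. (case \<omega> of (A, B, S) \<Rightarrow> if S 0 < A 0 then g (S 0, after_service \<omega>) else 0) \<partial>F)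
    = (\<integral>\<^sup>+ A. \<integral>\<^sup>+ B. \<integral>\<^sup>+ S. (if S 0 < A 0 then g (S 0, (residual (S 0) A, B, tail S)) else 0)
        \<partial>services \<partial>choices \<partial>arrivals)"
    by (subst nn_integral_future, measurable) (simp add: after_service_def cong: if_cong)
  also have "\<dots> = (\<integral>\<^sup>+ B. \<integral>\<^sup>+ S. \<integral>\<^sup>+ A. (if S 0 < A 0 then g (S 0, (residual (S 0) A, B, tail S)) else 0)
        \<partial>arrivals \<partial>services \<partial>choices)"
    by (rule swap) measurable
  also have "\<dots> = (\<integral>\<^sup>+ B. \<integral>\<^sup>+ S. ennreal (exp (- lam * S 0)) * (\<integral>\<^sup>+ A. g (S 0, (A, B, tail S)) \<partial>arrivals)
        \<partial>services \<partial>choices)"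
    by (rule nn_integral_cong, rule nn_integral_cong_AE, rule AE_mp[OF pos], rule AE_I2, rule impI,
        rule clocks_memoryless(2)[OF lam_pos]) (auto intro: less_imp_le)
  also have "\<dots> = (\<integral>\<^sup>+ B. \<integral>\<^sup>+ s. \<integral>\<^sup>+ S. ennreal (exp (- lam * s)) * (\<integral>\<^sup>+ A. g (s, (A, B, S)) \<partial>arrivals)
        \<partial>services \<partial>exponential mu \<partial>choices)"
    by (intro nn_integral_cong, subst nn_integral_PiM_case_nat[OF E.prob_space_axioms]) simp_all
  also have "\<dots> = (\<integral>\<^sup>+ s. \<integral>\<^sup>+ B. \<integral>\<^sup>+ S. ennreal (exp (- lam * s)) * (\<integral>\<^sup>+ A. g (s, (A, B, S)) \<partial>arrivals)
        \<partial>services \<partial>choices \<partial>exponential mu)"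
    by (intro EC.Fubini') measurable
  also have "\<dots> = (\<integral>\<^sup>+ s. ennreal (exp (- lam * s)) * (\<integral>\<^sup>+ \<omega>. g (s, \<omega>) \<partial>F) \<partial>exponential mu)"
    by (simp add: nn_integral_cmult nn_integral_future swap)
  also have "\<dots> = ennreal (mu / (mu + lam)) * (\<integral>\<^sup>+ t. \<integral>\<^sup>+ \<omega>. g (t, \<omega>) \<partial>F \<partial>exponential (mu + lam))"
    by (rule exponential_tilt) (use lam_pos mu_pos in \<open>auto simp: nn_integral_future\<close>)
  finally show ?thesis by (simp add: add.commute)
qed

end

section \<open>The busy period\<close>

text \<open>The asymmetry makes the property stable under both shifts: a tie counts as an arrival
  and leaves a residual service time of zero, whereas a service completes strictly before the next
  arrival. Positive interarrival times exclude arrivals at time 0.\<close>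

definition regular :: "future \<Rightarrow> bool" where
  "regular = (\<lambda>(A, B, S). (\<forall>k. 0 < A k) \<and> (\<forall>k. 0 \<le> S k))"

text \<open>The finiteness clause excludes the junk value of \<open>card\<close> in \<open>busy_arrivals\<close>.\<close>

definition empty_after :: "nat \<Rightarrow> nat \<Rightarrow> future \<Rightarrow> bool" where
  "empty_after N i = (\<lambda>(A, B, S). finite {n. arrival_time A n \<le> completion_time S N} \<and>
     i + busy_arrivals A B (completion_time S N) = N \<and>
     (\<forall>m<N. i + busy_arrivals A B (completion_time S m) \<noteq> m))"

text \<open>Here \<open>n\<close> counts events, i.e. arrivals to either queue and service completions.\<close>

primrec empties_within :: "nat \<Rightarrow> nat \<Rightarrow> future \<Rightarrow> bool" where
  "empties_within 0 i \<omega> \<longleftrightarrow> i = 0"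
| "empties_within (Suc n) i \<omega> \<longleftrightarrow> i = 0 \<or>
     (case \<omega> of (A, B, S) \<Rightarrow>
        if A 0 \<le> S 0
        then (if B 0 then empties_within n (Suc i) (after_arrival \<omega>) else empties_within n i (after_arrival \<omega>))
        else empties_within n (i - 1) (after_service \<omega>))"

lemma services_until_empty_eq: "empty_after N i \<omega> \<Longrightarrow> services_until_empty i \<omega> = N"
  unfolding services_until_empty_def empty_after_def
  by (auto split: prod.splits intro!: Least_equality simp flip: not_less)

lemma regular_after_arrival: "regular (A, B, S) \<Longrightarrow> A 0 \<le> S 0 \<Longrightarrow> regular (after_arrival (A, B, S))"
  by (auto simp: regular_def after_arrival_def tail_def residual_def split: nat.split)

lemma regular_after_service: "regular (A, B, S) \<Longrightarrow> S 0 < A 0 \<Longrightarrow> regular (after_service (A, B, S))"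
  by (auto simp: regular_def after_service_def tail_def residual_def split: nat.split)

lemma arrival_time_Suc: "arrival_time A (Suc n) = A 0 + arrival_time (tail A) n"
  unfolding arrival_time_def by (subst sum.atMost_Suc_shift) (simp add: tail_def)

lemma arrival_time_residual: "arrival_time (residual a A) n = arrival_time A n - a"
proof -
  have "arrival_time (residual a A) n = (\<Sum>k\<le>n. A k - (if k = 0 then a else 0))"
    unfolding arrival_time_def residual_def tail_def by (intro sum.cong) (auto split: nat.split)
  then show ?thesis by (simp add: sum_subtractf arrival_time_def)
qed

lemma completion_time_Suc: "completion_time S (Suc m) = S 0 + completion_time (tail S) m"
  unfolding completion_time_def by (subst sum.lessThan_Suc_shift) (simp add: tail_def)

lemma completion_time_residual:
  "0 < m \<Longrightarrow> completion_time (residual a S) m = completion_time S m - a"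
proof -
  assume "0 < m"
  have "completion_time (residual a S) m = (\<Sum>k<m. S k - (if k = 0 then a else 0))"
    unfolding completion_time_def residual_def tail_def by (intro sum.cong) (auto split: nat.split)
  then show ?thesis using \<open>0 < m\<close> by (simp add: sum_subtractf completion_time_def)
qed

lemma completion_time_mono: "(\<And>k. 0 \<le> S k) \<Longrightarrow> m \<le> n \<Longrightarrow> completion_time S m \<le> completion_time S n"
  unfolding completion_time_def by (intro sum_mono2) auto

lemma completion_time_nonneg: "(\<And>k. 0 \<le> S k) \<Longrightarrow> 0 \<le> completion_time S m"
  unfolding completion_time_def by (intro sum_nonneg) auto

lemma arrival_time_pos: "(\<And>k. 0 < A k) \<Longrightarrow> 0 < arrival_time A n"
  unfolding arrival_time_def by (intro sum_pos) auto

lemma busy_arrivals_0: "(\<And>k. 0 < A k) \<Longrightarrow> busy_arrivals A B 0 = 0"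
  using arrival_time_pos[of A] by (auto simp: busy_arrivals_def not_le[symmetric] simp del: not_le)

lemma empty_after_0: "regular \<omega> \<Longrightarrow> empty_after 0 0 \<omega>"
proof (cases \<omega>)
  case (fields A B S)
  assume "regular \<omega>"
  then have pos: "\<And>k. 0 < A k" by (auto simp: regular_def fields)
  have "{n. arrival_time A n \<le> 0} = {}" using arrival_time_pos[OF pos] by (auto simp: not_le)
  then show ?thesis using busy_arrivals_0[OF pos]
    by (simp add: empty_after_def fields completion_time_def)
qed

lemma busy_arrivals_after_arrival:
  assumes "0 \<le> t" and fin: "finite {n. arrival_time (tail A) n \<le> t}"
  shows "finite {n. arrival_time A n \<le> A 0 + t}"
    and "busy_arrivals A B (A 0 + t) = of_bool (B 0) + busy_arrivals (tail A) (tail B) t"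
proof -
  \<comment> \<open>Stated for a general \<open>P\<close> so that one reindexing gives both the
    finiteness (\<open>P\<close> always true) and the count (\<open>P = B\<close>).\<close>
  have eq: "{n. arrival_time A n \<le> A 0 + t \<and> P n}
      = (if P 0 then {0} else {}) \<union> Suc ` {n. arrival_time (tail A) n \<le> t \<and> P (Suc n)}" for P
  proof (intro set_eqI)
    fix n show "n \<in> {n. arrival_time A n \<le> A 0 + t \<and> P n} \<longleftrightarrow>
        n \<in> (if P 0 then {0} else {}) \<union> Suc ` {n. arrival_time (tail A) n \<le> t \<and> P (Suc n)}"
      using assms(1) by (cases n) (auto simp: arrival_time_Suc arrival_time_def[of A 0])
  qed
  show "finite {n. arrival_time A n \<le> A 0 + t}" using eq[of "\<lambda>_. True"] fin by simp
  have f: "finite {n. arrival_time (tail A) n \<le> t \<and> B (Suc n)}"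
    by (rule finite_subset[OF _ fin]) auto
  have "card (Suc ` {n. arrival_time (tail A) n \<le> t \<and> B (Suc n)}) = busy_arrivals (tail A) (tail B) t"
    by (simp add: card_image busy_arrivals_def tail_def)
  then show "busy_arrivals A B (A 0 + t) = of_bool (B 0) + busy_arrivals (tail A) (tail B) t"
    unfolding busy_arrivals_def[of A] eq using f by (subst card_Un_disjoint) auto
qed

text \<open>An arrival completes no service, so \<open>N\<close> is unchanged, and the newcomer
  moves from the count of later arrivals into the initial length. The time shift only applies to
  completion epochs with positive index; epoch 0 is excluded directly by
  \<open>0 < i\<close>.\<close>

lemma empty_after_arrival:
  assumes reg: "regular (A, B, S)" and le: "A 0 \<le> S 0" and i: "0 < i"
    and e: "empty_after N (i + of_bool (B 0)) (after_arrival (A, B, S))"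
  shows "empty_after N i (A, B, S)"
proof -
  let ?A = "tail A" and ?B = "tail B" and ?S = "residual (A 0) S"
  have reg': "regular (?A, ?B, ?S)" using regular_after_arrival[OF reg le] by (simp add: after_arrival_def)
  then have S0: "\<And>k. 0 \<le> ?S k" by (auto simp: regular_def)
  have fin: "finite {n. arrival_time ?A n \<le> completion_time ?S N}"
    and N: "i + of_bool (B 0) + busy_arrivals ?A ?B (completion_time ?S N) = N"
    and less: "\<And>m. m < N \<Longrightarrow> i + of_bool (B 0) + busy_arrivals ?A ?B (completion_time ?S m) \<noteq> m"
    using e by (auto simp: empty_after_def after_arrival_def)
  have Npos: "0 < N" using N i by linarith
  have shift: "completion_time S m = A 0 + completion_time ?S m" if "0 < m" for m
    using completion_time_residual[OF that, of "A 0" S] by simp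
  have step: "finite {n. arrival_time A n \<le> completion_time S m}"
    "busy_arrivals A B (completion_time S m) = of_bool (B 0) + busy_arrivals ?A ?B (completion_time ?S m)"
    if "0 < m" "m \<le> N" for m
  proof -
    have "finite {n. arrival_time ?A n \<le> completion_time ?S m}"
      using completion_time_mono[of ?S m N] S0 that(2) by (auto intro: finite_subset[OF _ fin])
    from busy_arrivals_after_arrival[OF completion_time_nonneg[of ?S m, OF S0] this]
    show "finite {n. arrival_time A n \<le> completion_time S m}"
      "busy_arrivals A B (completion_time S m) = of_bool (B 0) + busy_arrivals ?A ?B (completion_time ?S m)"
      unfolding shift[OF that(1)] by blast+
  qed
  have "i + busy_arrivals A B (completion_time S m) \<noteq> m" if "m < N" for m
  proof (cases "m = 0")
    case False
    then show ?thesis using step(2)[of m] less[OF that] that by simp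
  qed (use i in simp)
  then show ?thesis using step[OF Npos order_refl] N by (auto simp: empty_after_def)
qed

text \<open>Epoch \<open>Suc m\<close> becomes epoch \<open>m\<close> and the length drops by one,
  so both sides of the emptying equation change by one.\<close>

lemma empty_after_service:
  assumes reg: "regular (A, B, S)" and lt: "S 0 < A 0" and i: "0 < i"
    and e: "empty_after N (i - 1) (after_service (A, B, S))"
  shows "empty_after (Suc N) i (A, B, S)"
proof -
  let ?A = "residual (S 0) A" and ?S = "tail S"
  have fin: "finite {n. arrival_time ?A n \<le> completion_time ?S N}"
    and N: "i - 1 + busy_arrivals ?A B (completion_time ?S N) = N"
    and less: "\<And>m. m < N \<Longrightarrow> i - 1 + busy_arrivals ?A B (completion_time ?S m) \<noteq> m"
    using e by (auto simp: empty_after_def after_service_def)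
  have eq: "busy_arrivals A B (completion_time S (Suc m)) = busy_arrivals ?A B (completion_time ?S m)" for m
    unfolding busy_arrivals_def arrival_time_residual completion_time_Suc by (simp add: algebra_simps)
  have fin': "finite {n. arrival_time A n \<le> completion_time S (Suc N)}"
    using fin unfolding arrival_time_residual completion_time_Suc by (simp add: algebra_simps)
  have "i + busy_arrivals A B (completion_time S m) \<noteq> m" if "m < Suc N" for m
  proof (cases m)
    case (Suc k)
    then show ?thesis using less[of k] that i by (simp add: eq)
  qed (use i in simp)
  then show ?thesis using fin' N i by (simp add: empty_after_def eq)
qed

text \<open>Links the event-by-event recursion to the definition by LEAST: once the queue empties
  after finitely many events, the minimum exists and is not an arbitrary value.\<close>

lemma empties_within_imp_empty_after:
  "regular \<omega> \<Longrightarrow> empties_within n i \<omega> \<Longrightarrow> \<exists>N. empty_after N i \<omega>"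
proof (induction n arbitrary: i \<omega>)
  case 0
  then show ?case using empty_after_0[of \<omega>] by auto
next
  case (Suc n)
  obtain A B S where \<omega>: "\<omega> = (A, B, S)" by (cases \<omega>)
  show ?case
  proof (cases "i = 0")
    case True
    then show ?thesis using empty_after_0[of \<omega>] Suc.prems(1) by auto
  next
    case False
    show ?thesis
    proof (cases "A 0 \<le> S 0")
      case True
      then have "empties_within n (i + of_bool (B 0)) (after_arrival \<omega>)"
        using Suc.prems(2) False by (auto simp: \<omega>)
      from Suc.IH[OF _ this] regular_after_arrival Suc.prems(1) True
      obtain N where "empty_after N (i + of_bool (B 0)) (after_arrival \<omega>)" by (auto simp: \<omega>)
      then show ?thesis using empty_after_arrival[of A B S] False True Suc.prems(1) by (auto simp: \<omega>)
    next
      case le: False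
      then have "empties_within n (i - 1) (after_service \<omega>)"
        using Suc.prems(2) False by (auto simp: \<omega>)
      from Suc.IH[OF _ this] regular_after_service Suc.prems(1) le
      obtain N where "empty_after N (i - 1) (after_service \<omega>)" by (auto simp: \<omega>)
      then show ?thesis using empty_after_service[of A B S] False le Suc.prems(1) by (auto simp: \<omega>)
    qed
  qed
qed

lemma services_until_empty_0: "regular \<omega> \<Longrightarrow> services_until_empty 0 \<omega> = 0"
  by (intro services_until_empty_eq empty_after_0)

text \<open>Emptying of the shifted future is assumed because LEAST says nothing without it.
  Positivity is recorded because \<open>residual\<close> alters index 0 only: later epochs shift
  uniformly and later service times are untouched.\<close>

lemma services_until_empty_arrival:
  assumes "regular (A, B, S)" "A 0 \<le> S 0" "0 < i"
    and "empties_within n (i + of_bool (B 0)) (after_arrival (A, B, S))"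
  shows "services_until_empty i (A, B, S) = services_until_empty (i + of_bool (B 0)) (after_arrival (A, B, S))"
    and "0 < services_until_empty i (A, B, S)"
proof -
  obtain N where N: "empty_after N (i + of_bool (B 0)) (after_arrival (A, B, S))"
    using empties_within_imp_empty_after[OF regular_after_arrival] assms by blast
  have M: "empty_after N i (A, B, S)" by (rule empty_after_arrival) fact+
  show "services_until_empty i (A, B, S) = services_until_empty (i + of_bool (B 0)) (after_arrival (A, B, S))"
    using services_until_empty_eq[OF N] services_until_empty_eq[OF M] by simp
  have "i \<le> N" using M by (auto simp: empty_after_def)
  then show "0 < services_until_empty i (A, B, S)" using assms(3) services_until_empty_eq[OF M] by simp
qed

lemma services_until_empty_service:
  assumes "regular (A, B, S)" "S 0 < A 0" "0 < i"
    and "empties_within n (i - 1) (after_service (A, B, S))"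
  shows "services_until_empty i (A, B, S) = Suc (services_until_empty (i - 1) (after_service (A, B, S)))"
proof -
  obtain N where N: "empty_after N (i - 1) (after_service (A, B, S))"
    using empties_within_imp_empty_after[OF regular_after_service] assms by blast
  have M: "empty_after (Suc N) i (A, B, S)" by (rule empty_after_service) fact+
  show ?thesis
    using services_until_empty_eq[OF N] services_until_empty_eq[OF M] by simp
qed

lemma empties_within_mono: "empties_within n i \<omega> \<Longrightarrow> empties_within (Suc n) i \<omega>"
proof (induction n arbitrary: i \<omega>)
  case (Suc n)
  obtain A B S where \<omega>: "\<omega> = (A, B, S)" by (cases \<omega>)
  show ?case
    unfolding empties_within.simps(2)[of "Suc n"] \<omega> prod.case
    using Suc.prems[unfolded empties_within.simps(2)[of n] \<omega> prod.case]
      Suc.IH[of _ "after_arrival (A, B, S)"] Suc.IH[of _ "after_service (A, B, S)"]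
    by (auto simp del: empties_within.simps)
qed simp

lemma measurable_choice [measurable]: "Measurable.pred futures (\<lambda>\<omega>. fst (snd \<omega>) n)"
proof -
  have "(\<lambda>B. B n) \<in> measurable (sequences (count_space UNIV)) (count_space (UNIV :: bool set))"
    by (rule measurable_component_singleton) simp
  from measurable_compose[OF measurable_compose[OF measurable_snd measurable_fst] this]
  show ?thesis .
qed

lemma measurable_empties_within [measurable]: "Measurable.pred futures (empties_within n i)"
proof (induction n arbitrary: i)
  case 0
  then show ?case by simp
next
  case (Suc n)
  note Suc[measurable]
  have "empties_within (Suc n) i = (\<lambda>\<omega>. i = 0 \<or>
        (if fst \<omega> 0 \<le> snd (snd \<omega>) 0
        then (if fst (snd \<omega>) 0 then empties_within n (Suc i) (after_arrival \<omega>) else empties_within n i (after_arrival \<omega>))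
        else empties_within n (i - 1) (after_service \<omega>)))"
    by (auto simp: fun_eq_iff)
  also have "Measurable.pred futures \<dots>" by measurable
  finally show ?case .
qed

lemma measurable_services_until_empty [measurable]:
  "services_until_empty i \<in> measurable futures (count_space UNIV)"
proof -
  have [measurable]: "(\<lambda>\<omega>. card {n. (\<Sum>k\<le>n. fst \<omega> k) \<le> (\<Sum>k<m. snd (snd \<omega>) k) \<and> fst (snd \<omega>) n})
      \<in> measurable futures (count_space UNIV)" for m
  proof (rule measurable_card)
    fix n
    have "(\<lambda>\<omega>. \<Sum>k\<le>n. fst \<omega> k) \<in> borel_measurable futures"
      "(\<lambda>\<omega>. \<Sum>k<m. snd (snd \<omega>) k) \<in> borel_measurable futures"
      by (intro borel_measurable_sum; measurable)+
    then have "Measurable.pred futures (\<lambda>\<omega>. (\<Sum>k\<le>n. fst \<omega> k) \<le> (\<Sum>k<m. snd (snd \<omega>) k))"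
      unfolding pred_def by (rule borel_measurable_le)
    then have "{\<omega> \<in> space futures. (\<Sum>k\<le>n. fst \<omega> k) \<le> (\<Sum>k<m. snd (snd \<omega>) k) \<and> fst (snd \<omega>) n} \<in> sets futures"
      using measurable_choice[of n] unfolding pred_def by (intro sets.sets_Collect_conj)
    then show "{\<omega> \<in> space futures. n \<in> {n. (\<Sum>k\<le>n. fst \<omega> k) \<le> (\<Sum>k<m. snd (snd \<omega>) k) \<and> fst (snd \<omega>) n}} \<in> sets futures"
      by simp
  qed
  have "services_until_empty i = (\<lambda>\<omega>. LEAST m. i + card {n. (\<Sum>k\<le>n. fst \<omega> k) \<le> (\<Sum>k<m. snd (snd \<omega>) k) \<and> fst (snd \<omega>) n} = m)"
    by (auto simp: fun_eq_iff services_until_empty_def busy_arrivals_def arrival_time_def completion_time_def)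
  also have "\<dots> \<in> measurable futures (count_space UNIV)"
    by measurable
  finally show ?thesis .
qed

text \<open>
  A solution of the homogeneous recurrence has geometrically growing increments unless it
  vanishes, so at most one solution grows linearly.
\<close>

lemma linear_growth_recurrence_zero:
  fixes d :: "nat \<Rightarrow> real"
  assumes r: "0 \<le> r" "r < 1" and d0: "d 0 = 0"
    and rec: "\<And>i. r * (d (i + 2) - d (i + 1)) = d (i + 1) - d i"
    and growth: "\<And>i. \<bar>d i\<bar> \<le> C * (1 + real i)"
  shows "d i = 0"
proof -
  \<comment> \<open>With the power of \<open>r\<close> on this side there is no division, so
    \<open>r = 0\<close>, the case where nobody joins the busy queue, is included.\<close>
  have inc: "d (j + 1) - d j = r ^ n * (d (j + n + 1) - d (j + n))" for n j
  proof (induction n)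
    case (Suc n)
    then show ?case using rec[of "j + n"] by (simp add: mult.assoc)
  qed simp
  have zero: "d (j + 1) - d j = 0" for j
  proof -
    have C: "0 \<le> C" using growth[of 0] by simp
    have "(\<lambda>n. real n * r ^ n) \<longlonglongrightarrow> 0" using r by (intro powser_times_n_limit_0) simp
    moreover have "(\<lambda>n. r ^ n) \<longlonglongrightarrow> 0" using r by (intro LIMSEQ_power_zero) simp
    ultimately have "(\<lambda>n. 2 * C * (real n * r ^ n) + C * (3 + 2 * real j) * r ^ n) \<longlonglongrightarrow> 2 * C * 0 + C * (3 + 2 * real j) * 0"
      by (intro tendsto_add tendsto_mult_left)
    then have lim: "(\<lambda>n. 2 * C * (real n * r ^ n) + C * (3 + 2 * real j) * r ^ n) \<longlonglongrightarrow> 0" by simp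
    have "\<bar>d (j + 1) - d j\<bar> \<le> 2 * C * (real n * r ^ n) + C * (3 + 2 * real j) * r ^ n" for n
    proof -
      have "\<bar>d (j + n + 1) - d (j + n)\<bar> \<le> C * (1 + real (j + n + 1)) + C * (1 + real (j + n))"
        using growth[of "j + n + 1"] growth[of "j + n"] by linarith
      then have "r ^ n * \<bar>d (j + n + 1) - d (j + n)\<bar> \<le> r ^ n * (C * (1 + real (j + n + 1)) + C * (1 + real (j + n)))"
        using r by (intro mult_left_mono) auto
      also have "\<dots> = 2 * C * (real n * r ^ n) + C * (3 + 2 * real j) * r ^ n" by (simp add: algebra_simps)
      finally show ?thesis using r unfolding inc[of j n] abs_mult by simp
    qed
    then have "\<bar>d (j + 1) - d j\<bar> \<le> 0"
      by (intro LIMSEQ_le_const[OF lim]) auto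
    then show ?thesis by simp
  qed
  show ?thesis
  proof (induction i)
    case (Suc i)
    then show ?case using zero[of i] by simp
  qed (use d0 in simp)
qed

context polling begin

lemma drain_rate_pos: "0 < mu - lam * p"
  using lam_less mult_left_mono[OF p_le_1, of lam] lam_pos by linarith

text \<open>Here \<open>e n i\<close> stands for an expectation restricted to emptying within
  \<open>n\<close> events and \<open>u n i\<close> for the probability of that event. Monotone
  limits \<open>E\<close> exist and solve the untruncated recurrence; their distance from the
  candidate solves the homogeneous one with ratio \<open>lam * p / mu\<close>. Convergence is
  required of \<open>\<alpha> * u n i\<close> only, which is trivial for \<open>\<alpha> = 0\<close>
  and thereby lets the same lemma prove that emptying is certain.\<close>

lemma truncated_recursion_limit:
  fixes e u :: "nat \<Rightarrow> nat \<Rightarrow> real"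
  assumes rec: "\<And>n i. 0 < i \<Longrightarrow> e (Suc n) i =
      lam / (lam + mu) * (\<alpha> / (lam + mu) * (p * u n (Suc i) + (1 - p) * u n i) + (p * e n (Suc i) + (1 - p) * e n i))
    + mu / (lam + mu) * (\<alpha> / (lam + mu) * u n (i - 1) + e n (i - 1))"
    and mono: "\<And>n i. e n i \<le> e (Suc n) i" and nonneg: "\<And>n i. 0 \<le> e n i"
    and bound: "\<And>n i. e n i \<le> x0 + \<alpha> * real i / (mu - lam * p)"
    and base: "\<And>n. e n 0 = x0"
    and u: "\<And>i. (\<lambda>n. \<alpha> * u n i) \<longlonglongrightarrow> \<alpha>" and \<alpha>: "0 \<le> \<alpha>"
  shows "(\<lambda>n. e n i) \<longlonglongrightarrow> x0 + \<alpha> * real i / (mu - lam * p)"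
proof -
  let ?D = "mu - lam * p" and ?L = "lam + mu"
  have L: "?L > 0" using lam_pos mu_pos by simp
  have "\<exists>l. (\<lambda>n. e n i) \<longlonglongrightarrow> l" for i
    using incseq_convergent[of "\<lambda>n. e n i"] mono bound by (metis incseq_SucI)
  then obtain E where E: "\<And>i. (\<lambda>n. e n i) \<longlonglongrightarrow> E i" by metis
  have E0: "E 0 = x0" using E[of 0] by (simp add: base LIMSEQ_const_iff)
  have E_bound: "0 \<le> E i" "E i \<le> x0 + \<alpha> * real i / ?D" for i
    using E[of i] by (auto intro: LIMSEQ_le_const LIMSEQ_le_const2 nonneg bound)
  have recE: "?L * E i = \<alpha> + lam * (p * E (Suc i) + (1 - p) * E i) + mu * E (i - 1)" if "0 < i" for i
  proof -
    have eq: "?L * e (Suc n) i = lam / ?L * (p * (\<alpha> * u n (Suc i)) + (1 - p) * (\<alpha> * u n i))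
        + mu / ?L * (\<alpha> * u n (i - 1)) + lam * (p * e n (Suc i) + (1 - p) * e n i) + mu * e n (i - 1)" for n
    proof -
      have "k * (lam / k * (\<alpha> / k * X + Y) + mu / k * (\<alpha> / k * U + V))
          = lam / k * (\<alpha> * X) + mu / k * (\<alpha> * U) + lam * Y + mu * V" if "0 < k" for k X Y U V
        using that by (simp add: distrib_left)
      note cancel = this[OF L]
      show ?thesis unfolding rec[OF that] cancel by (simp only: distrib_left mult.left_commute[of \<alpha>])
    qed
    have "(\<lambda>n. ?L * e (Suc n) i) \<longlonglongrightarrow> lam / ?L * (p * \<alpha> + (1 - p) * \<alpha>)
        + mu / ?L * \<alpha> + lam * (p * E (Suc i) + (1 - p) * E i) + mu * E (i - 1)"
      unfolding eq by (intro tendsto_intros E u)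
    moreover have "(\<lambda>n. ?L * e (Suc n) i) \<longlonglongrightarrow> ?L * E i"
      by (intro tendsto_intros LIMSEQ_Suc E)
    ultimately have "?L * E i = lam / ?L * (p * \<alpha> + (1 - p) * \<alpha>)
        + mu / ?L * \<alpha> + lam * (p * E (Suc i) + (1 - p) * E i) + mu * E (i - 1)"
      by (rule LIMSEQ_unique[rotated])
    moreover have "lam / ?L * (p * \<alpha> + (1 - p) * \<alpha>) + mu / ?L * \<alpha> = \<alpha>"
    proof -
      have "p * \<alpha> + (1 - p) * \<alpha> = \<alpha>" by (simp add: algebra_simps)
      moreover have "lam / ?L * \<alpha> + mu / ?L * \<alpha> = \<alpha>"
        using L unfolding distrib_right[symmetric] add_divide_distrib[symmetric] by simp
      ultimately show ?thesis by simp
    qed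
    ultimately show ?thesis by simp
  qed
  define d where "d i = E i - x0 - \<alpha> * real i / ?D" for i
  have "d i = 0"
  \<comment> \<open>The growth constant is crude: \<open>E i\<close> lies between 0 and the
    candidate, so the distance is at most the candidate itself.\<close>
  proof (rule linear_growth_recurrence_zero[of "lam * p / mu" d "x0 + \<alpha> / ?D"])
    show "0 \<le> lam * p / mu" "lam * p / mu < 1"
      using lam_pos mu_pos p_nonneg drain_rate_pos by auto
    show "d 0 = 0" by (simp add: d_def E0)
    show "lam * p / mu * (d (i + 2) - d (i + 1)) = d (i + 1) - d i" for i
    proof -
      have a: "d (i + 2) - d (i + 1) = E (i + 2) - E (i + 1) - \<alpha> / ?D"
        "d (i + 1) - d i = E (i + 1) - E i - \<alpha> / ?D"
        by (simp_all add: d_def algebra_simps add_divide_distrib)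
      have "lam * p * (E (i + 2) - E (i + 1)) + \<alpha> = mu * (E (i + 1) - E i)"
        using recE[of "i + 1"] by (simp add: algebra_simps)
      moreover have "\<alpha> = (mu - lam * p) * (\<alpha> / ?D)" using drain_rate_pos by simp
      ultimately have "lam * p * (E (i + 2) - E (i + 1) - \<alpha> / ?D) = mu * (E (i + 1) - E i - \<alpha> / ?D)"
        by (simp only: algebra_simps)
      then show ?thesis unfolding a using mu_pos by (simp add: field_simps)
    qed
    show "\<bar>d i\<bar> \<le> (x0 + \<alpha> / ?D) * (1 + real i)" for i
    proof -
      have x0: "0 \<le> x0" using nonneg[of 0 0] by (simp add: base)
      have b: "0 \<le> \<alpha> / ?D" using \<alpha> drain_rate_pos by simp
      have "\<bar>d i\<bar> \<le> x0 + \<alpha> / ?D * real i" using E_bound[of i] by (auto simp: d_def abs_le_iff)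
      also have "\<dots> \<le> (x0 + \<alpha> / ?D) * (1 + real i)"
      proof -
        have "(x0 + s) * (1 + real i) = x0 + s * real i + (x0 * real i + s)" for s
          by (simp add: algebra_simps)
        moreover have "0 \<le> x0 * real i + \<alpha> / ?D" using x0 b by simp
        ultimately show ?thesis by simp
      qed
      finally show ?thesis .
    qed
  qed
  then have "E i = x0 + \<alpha> * real i / ?D" by (simp add: d_def)
  with E[of i] show ?thesis by simp
qed

lemma measurable_regular [measurable]: "Measurable.pred futures regular"
proof -
  have "regular = (\<lambda>\<omega>. (\<forall>k. 0 < fst \<omega> k) \<and> (\<forall>k. 0 \<le> snd (snd \<omega>) k))"
    by (auto simp: regular_def fun_eq_iff)
  also have "Measurable.pred futures \<dots>" by measurable
  finally show ?thesis .
qed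

lemma AE_regular: "AE \<omega> in F. regular \<omega>"
proof -
  have "(\<integral>\<^sup>+ \<omega>. (if regular \<omega> then 0 else 1) \<partial>F)
     = (\<integral>\<^sup>+ A. \<integral>\<^sup>+ B. \<integral>\<^sup>+ S. (if regular (A, B, S) then 0 else 1) \<partial>services \<partial>choices \<partial>arrivals)"
    by (rule nn_integral_future) measurable
  also have "\<dots> = (\<integral>\<^sup>+ A. \<integral>\<^sup>+ B. \<integral>\<^sup>+ S. 0 \<partial>services \<partial>choices \<partial>arrivals)"
  proof (rule nn_integral_cong_AE, rule AE_mp[OF AE_clocks[OF lam_pos]], rule AE_I2, rule impI, rule nn_integral_cong)
    fix A :: "nat \<Rightarrow> real" and B :: "nat \<Rightarrow> bool" assume "\<forall>k. 0 < A k"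
    then show "(\<integral>\<^sup>+ S. (if regular (A, B, S) then 0 else 1) \<partial>services) = (\<integral>\<^sup>+ S. 0 \<partial>services)"
      by (intro nn_integral_cong_AE, intro AE_mp[OF AE_clocks[OF mu_pos] AE_I2])
         (auto simp: regular_def less_imp_le)
  qed
  finally have "(\<integral>\<^sup>+ \<omega>. (if regular \<omega> then 0 else 1) \<partial>F) = 0" by simp
  then have "AE \<omega> in F. (if regular \<omega> then 0 else 1) = (0 :: ennreal)"
    by (subst (asm) nn_integral_0_iff_AE) measurable
  then show ?thesis by (auto elim!: eventually_mono split: if_splits)
qed


definition empties_prob :: "nat \<Rightarrow> nat \<Rightarrow> ennreal" where
  "empties_prob n i = (\<integral>\<^sup>+ \<omega>. (if empties_within n i \<omega> then 1 else 0) \<partial>F)"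

lemma empties_prob_le_1: "empties_prob n i \<le> 1"
proof -
  interpret F: prob_space F by (rule prob_space_future)
  have "empties_prob n i \<le> (\<integral>\<^sup>+ \<omega>. 1 \<partial>F)" unfolding empties_prob_def by (intro nn_integral_mono) auto
  then show ?thesis by (simp add: F.emeasure_space_1)
qed

end

section \<open>Expectations of busy period functionals\<close>

text \<open>
  Functionals \<open>X i\<close> of a busy period started with \<open>i\<close> customers that accumulate at rate \<open>\<alpha>\<close>
  while the server stays at the busy queue: \<open>\<alpha> = 1\<close> for its length, and \<open>\<alpha> = 0\<close> for
  quantities determined after its end.
\<close>

locale busy_period_functional = polling +
  fixes X :: "nat \<Rightarrow> future \<Rightarrow> real" and \<alpha> x0 :: real
  assumes X_measurable [measurable]: "\<And>i. X i \<in> borel_measurable futures"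
    and X_nonneg: "\<And>i \<omega>. regular \<omega> \<Longrightarrow> 0 \<le> X i \<omega>"
    and X_arrival: "\<And>A B S n i. regular (A, B, S) \<Longrightarrow> A 0 \<le> S 0 \<Longrightarrow> 0 < i \<Longrightarrow>
        empties_within n (i + of_bool (B 0)) (after_arrival (A, B, S)) \<Longrightarrow>
        X i (A, B, S) = \<alpha> * A 0 + X (i + of_bool (B 0)) (after_arrival (A, B, S))"
    and X_service: "\<And>A B S n i. regular (A, B, S) \<Longrightarrow> S 0 < A 0 \<Longrightarrow> 0 < i \<Longrightarrow>
        empties_within n (i - 1) (after_service (A, B, S)) \<Longrightarrow>
        X i (A, B, S) = \<alpha> * S 0 + X (i - 1) (after_service (A, B, S))"
    and \<alpha>_nonneg: "0 \<le> \<alpha>" and x0_nonneg: "0 \<le> x0"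
    and X_0: "(\<integral>\<^sup>+ \<omega>. ennreal (X 0 \<omega>) \<partial>F) = ennreal x0"
begin

text \<open>Restriction to emptying within \<open>n\<close> events turns first-event analysis into a
  recursion on \<open>n\<close> and discards futures on which the functional may be
  arbitrary.\<close>

definition truncated :: "nat \<Rightarrow> nat \<Rightarrow> ennreal" where
  "truncated n i = (\<integral>\<^sup>+ \<omega>. (if empties_within n i \<omega> then ennreal (X i \<omega>) else 0) \<partial>F)"

lemma truncated_0: "truncated n 0 = ennreal x0"
proof -
  have "empties_within n 0 \<omega>" for \<omega> by (cases n) auto
  then show ?thesis by (simp add: truncated_def X_0)
qed

lemma truncated_0': "0 < i \<Longrightarrow> truncated 0 i = 0"
  by (simp add: truncated_def)

text \<open>The time to the first event has mean \<open>1 / (lam + mu)\<close> and is independent of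
  what follows, but it is counted only if the remaining future empties within \<open>n\<close>
  events; hence the factors \<open>empties_prob\<close>.\<close>

lemma truncated_Suc:
  assumes i: "0 < i"
  shows "truncated (Suc n) i =
      ennreal (lam / (lam + mu)) * (ennreal p * (ennreal (\<alpha> / (lam + mu)) * empties_prob n (Suc i) + truncated n (Suc i))
          + ennreal (1 - p) * (ennreal (\<alpha> / (lam + mu)) * empties_prob n i + truncated n i))
    + ennreal (mu / (lam + mu)) * (ennreal (\<alpha> / (lam + mu)) * empties_prob n (i - 1) + truncated n (i - 1))"
proof -
  have L: "0 < lam + mu" using lam_pos mu_pos by simp
  interpret L: prob_space "exponential (lam + mu)" by (rule prob_space_exponential[OF L])
  define h where "h k = (\<lambda>(t, \<omega>). if empties_within n k \<omega> then ennreal (\<alpha> * t) + ennreal (X k \<omega>) else 0)" for k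
  have [measurable]: "h k \<in> borel_measurable (borel \<Otimes>\<^sub>M futures)" for k unfolding h_def by measurable
  define f where "f = (\<lambda>(t :: real, b, \<omega>). if b then h (Suc i) (t, \<omega>) else h i (t, \<omega>))"
  have [measurable]: "f \<in> borel_measurable (borel \<Otimes>\<^sub>M count_space UNIV \<Otimes>\<^sub>M futures)" unfolding f_def by measurable
  have h_int: "(\<integral>\<^sup>+ \<omega>. h k (t, \<omega>) \<partial>F) = ennreal (\<alpha> * t) * empties_prob n k + truncated n k" for k t
  proof -
    have "(\<integral>\<^sup>+ \<omega>. h k (t, \<omega>) \<partial>F) = (\<integral>\<^sup>+ \<omega>. ennreal (\<alpha> * t) * (if empties_within n k \<omega> then 1 else 0)
        + (if empties_within n k \<omega> then ennreal (X k \<omega>) else 0) \<partial>F)"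
      by (intro nn_integral_cong) (auto simp: h_def)
    then show ?thesis by (simp add: nn_integral_add nn_integral_cmult empties_prob_def truncated_def)
  qed
  have t_int: "(\<integral>\<^sup>+ t. ennreal (\<alpha> * t) \<partial>exponential (lam + mu)) = ennreal (\<alpha> / (lam + mu))"
  proof -
    have "(\<integral>\<^sup>+ t. ennreal (\<alpha> * t) \<partial>exponential (lam + mu)) = (\<integral>\<^sup>+ t. ennreal \<alpha> * ennreal t \<partial>exponential (lam + mu))"
      by (intro nn_integral_cong) (simp add: ennreal_mult' \<alpha>_nonneg)
    also have "\<dots> = ennreal \<alpha> * ennreal (1 / (lam + mu))"
      by (simp add: nn_integral_cmult nn_integral_exponential_id[OF L])
    also have "\<dots> = ennreal (\<alpha> / (lam + mu))" using L \<alpha>_nonneg by (simp flip: ennreal_mult)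
    finally show ?thesis .
  qed
  have "truncated (Suc n) i = (\<integral>\<^sup>+ \<omega>.
       (case \<omega> of (A, B, S) \<Rightarrow> if A 0 \<le> S 0 then f (A 0, B 0, after_arrival \<omega>) else 0)
     + (case \<omega> of (A, B, S) \<Rightarrow> if S 0 < A 0 then h (i - 1) (S 0, after_service \<omega>) else 0) \<partial>F)"
    unfolding truncated_def
  proof (rule nn_integral_cong_AE, rule AE_mp[OF AE_regular AE_I2], rule impI)
    fix \<omega> assume reg: "regular \<omega>"
    obtain A B S where \<omega>: "\<omega> = (A, B, S)" by (cases \<omega>)
    have AS: "0 \<le> A 0" "0 \<le> S 0" using reg by (auto simp: regular_def \<omega> less_imp_le)
    show "(if empties_within (Suc n) i \<omega> then ennreal (X i \<omega>) else 0) =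
       (case \<omega> of (A, B, S) \<Rightarrow> if A 0 \<le> S 0 then f (A 0, B 0, after_arrival \<omega>) else 0)
     + (case \<omega> of (A, B, S) \<Rightarrow> if S 0 < A 0 then h (i - 1) (S 0, after_service \<omega>) else 0)"
    proof (cases "A 0 \<le> S 0")
      case True
      have nn: "0 \<le> X k (after_arrival \<omega>)" for k
        using regular_after_arrival True reg by (auto intro!: X_nonneg simp: \<omega>)
      have "f (A 0, B 0, after_arrival \<omega>) = h (i + of_bool (B 0)) (A 0, after_arrival \<omega>)"
        by (simp add: f_def)
      moreover have "empties_within (Suc n) i \<omega> \<longleftrightarrow> empties_within n (i + of_bool (B 0)) (after_arrival \<omega>)"
        using True i by (simp add: \<omega>)
      ultimately show ?thesis
        using True X_arrival[of A B S i n] reg i AS \<alpha>_nonneg nn[of "i + of_bool (B 0)"]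
        by (simp add: \<omega> h_def ennreal_plus del: empties_within.simps)
    next
      case False
      have nn: "0 \<le> X k (after_service \<omega>)" for k
        using regular_after_service False reg by (auto intro!: X_nonneg simp: \<omega>)
      have "empties_within (Suc n) i \<omega> \<longleftrightarrow> empties_within n (i - 1) (after_service \<omega>)"
        using False i by (simp add: \<omega>)
      then show ?thesis
        using False X_service[of A B S i n] reg i AS \<alpha>_nonneg nn[of "i - 1"]
        by (simp add: \<omega> h_def ennreal_plus del: empties_within.simps)
    qed
  qed
  also have "\<dots> = (\<integral>\<^sup>+ \<omega>. (case \<omega> of (A, B, S) \<Rightarrow> if A 0 \<le> S 0 then f (A 0, B 0, after_arrival \<omega>) else 0) \<partial>F)
     + (\<integral>\<^sup>+ \<omega>. (case \<omega> of (A, B, S) \<Rightarrow> if S 0 < A 0 then h (i - 1) (S 0, after_service \<omega>) else 0) \<partial>F)"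
    by (rule nn_integral_add) measurable
  also have "\<dots> = ennreal (lam / (lam + mu)) * (\<integral>\<^sup>+ t. \<integral>\<^sup>+ b. \<integral>\<^sup>+ \<omega>. f (t, b, \<omega>) \<partial>F \<partial>measure_pmf (bernoulli_pmf p) \<partial>exponential (lam + mu))
     + ennreal (mu / (lam + mu)) * (\<integral>\<^sup>+ t. \<integral>\<^sup>+ \<omega>. h (i - 1) (t, \<omega>) \<partial>F \<partial>exponential (lam + mu))"
    by (subst first_event_arrival, measurable, subst first_event_service, measurable)
  also have "(\<integral>\<^sup>+ t. \<integral>\<^sup>+ b. \<integral>\<^sup>+ \<omega>. f (t, b, \<omega>) \<partial>F \<partial>measure_pmf (bernoulli_pmf p) \<partial>exponential (lam + mu))
     = (\<integral>\<^sup>+ t. ennreal p * (ennreal (\<alpha> * t) * empties_prob n (Suc i) + truncated n (Suc i))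
          + ennreal (1 - p) * (ennreal (\<alpha> * t) * empties_prob n i + truncated n i) \<partial>exponential (lam + mu))"
    using p_nonneg p_le_1 by (simp add: f_def h_int mult.commute)
  also have "\<dots> = ennreal p * (ennreal (\<alpha> / (lam + mu)) * empties_prob n (Suc i) + truncated n (Suc i))
          + ennreal (1 - p) * (ennreal (\<alpha> / (lam + mu)) * empties_prob n i + truncated n i)"
    by (simp add: nn_integral_add nn_integral_cmult nn_integral_multc t_int L.emeasure_space_1[simplified])
  also have "(\<integral>\<^sup>+ t. \<integral>\<^sup>+ \<omega>. h (i - 1) (t, \<omega>) \<partial>F \<partial>exponential (lam + mu))
     = ennreal (\<alpha> / (lam + mu)) * empties_prob n (i - 1) + truncated n (i - 1)"
    by (simp add: h_int nn_integral_add nn_integral_multc t_int L.emeasure_space_1[simplified])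
  finally show ?thesis .
qed

text \<open>The affine candidate is a fixed point of the recursion once each
  \<open>empties_prob\<close> is replaced by its upper bound 1. It is therefore a supersolution, and
  induction keeps the truncated values below it.\<close>

lemma truncated_bound: "truncated n i \<le> ennreal (x0 + \<alpha> * real i / (mu - lam * p))"
proof (induction n arbitrary: i)
  case 0
  then show ?case using truncated_0[of 0] truncated_0'[of i] by (cases "i = 0") auto
next
  case (Suc n)
  show ?case
  proof (cases "i = 0")
    case True
    then show ?thesis by (simp add: truncated_0)
  next
    case False
    let ?D = "mu - lam * p" and ?L = "lam + mu"
    define v where "v k = x0 + \<alpha> * real k / ?D" for k
    have L: "?L > 0" using lam_pos mu_pos by simp
    have v: "0 \<le> v k" for k using x0_nonneg \<alpha>_nonneg drain_rate_pos by (simp add: v_def)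
    have IH: "truncated n k \<le> ennreal (v k)" for k using Suc.IH by (simp add: v_def)
    have part: "ennreal (\<alpha> / ?L) * empties_prob n k + truncated n k \<le> ennreal (\<alpha> / ?L + v k)" for k
    proof -
      have "ennreal (\<alpha> / ?L) * empties_prob n k + truncated n k \<le> ennreal (\<alpha> / ?L) * 1 + ennreal (v k)"
        by (intro add_mono mult_left_mono IH empties_prob_le_1) auto
      then show ?thesis using v[of k] \<alpha>_nonneg L by (simp add: ennreal_plus)
    qed
    have "truncated (Suc n) i \<le>
       ennreal (lam / ?L) * (ennreal p * ennreal (\<alpha> / ?L + v (Suc i)) + ennreal (1 - p) * ennreal (\<alpha> / ?L + v i))
       + ennreal (mu / ?L) * ennreal (\<alpha> / ?L + v (i - 1))"
      unfolding truncated_Suc[OF False[folded neq0_conv[symmetric], unfolded neq0_conv]]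
      by (intro add_mono mult_left_mono part) auto
    also have "\<dots> = ennreal (lam / ?L * (p * (\<alpha> / ?L + v (Suc i)) + (1 - p) * (\<alpha> / ?L + v i)) + mu / ?L * (\<alpha> / ?L + v (i - 1)))"
      using v \<alpha>_nonneg L lam_pos mu_pos p_nonneg p_le_1 by (simp flip: ennreal_plus ennreal_mult)
    also have "lam / ?L * (p * (\<alpha> / ?L + v (Suc i)) + (1 - p) * (\<alpha> / ?L + v i)) + mu / ?L * (\<alpha> / ?L + v (i - 1)) = v i"
    proof -
      define s where "s = \<alpha> / ?D"
      have vs: "v (Suc i) = v i + s" "v (i - 1) = v i - s"
        using False by (auto simp: v_def s_def of_nat_diff algebra_simps add_divide_distrib diff_divide_distrib)
      define t where "t = \<alpha> / ?L"
      have s: "(mu - lam * p) * s = \<alpha>" using drain_rate_pos by (simp add: s_def)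
      have t: "(lam + mu) * t = \<alpha>" using L by (simp add: t_def)
      have "lam * (p * (t + v (Suc i)) + (1 - p) * (t + v i)) + mu * (t + v (i - 1))
         = (lam + mu) * t + (lam + mu) * v i - (mu - lam * p) * s"
        unfolding vs by (simp add: algebra_simps)
      then have "(lam * (p * (t + v (Suc i)) + (1 - p) * (t + v i)) + mu * (t + v (i - 1))) / ?L = v i"
        unfolding s t using L by simp
      then show ?thesis by (simp add: add_divide_distrib flip: t_def)
    qed
    finally show ?thesis by (simp add: v_def)
  qed
qed

lemma truncated_mono: "truncated n i \<le> truncated (Suc n) i"
  unfolding truncated_def using empties_within_mono[of n i]
  by (intro nn_integral_mono) (auto simp del: empties_within.simps)

lemma truncated_limit:
  assumes u: "\<And>i. (\<lambda>n. \<alpha> * enn2real (empties_prob n i)) \<longlonglongrightarrow> \<alpha>"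
  shows "(SUP n. truncated n i) = ennreal (x0 + \<alpha> * real i / (mu - lam * p))"
proof -
  define e where "e n k = enn2real (truncated n k)" for n k
  define w where "w n k = enn2real (empties_prob n k)" for n k
  have te: "truncated n k = ennreal (e n k)" for n k
    unfolding e_def using truncated_bound[of n k]
    by (metis ennreal_enn2real ennreal_less_top order_le_less_trans)
  have tw: "empties_prob n k = ennreal (w n k)" for n k
    unfolding w_def using empties_prob_le_1[of n k]
    by (metis ennreal_enn2real ennreal_one_less_top order_le_less_trans)
  have e0: "0 \<le> e n k" "0 \<le> w n k" for n k by (auto simp: e_def w_def)
  have lim: "(\<lambda>n. e n i) \<longlonglongrightarrow> x0 + \<alpha> * real i / (mu - lam * p)"
  proof (rule truncated_recursion_limit[where u = w])
    fix n i :: nat assume i: "0 < i"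
    let ?R = "lam / (lam + mu) * (p * (\<alpha> / (lam + mu) * w n (Suc i) + e n (Suc i)) + (1 - p) * (\<alpha> / (lam + mu) * w n i + e n i))
      + mu / (lam + mu) * (\<alpha> / (lam + mu) * w n (i - 1) + e n (i - 1))"
    have R: "0 \<le> ?R" using e0 \<alpha>_nonneg lam_pos mu_pos p_nonneg p_le_1 by simp
    have "ennreal (e (Suc n) i) = ennreal ?R"
      using truncated_Suc[OF i, of n] e0 \<alpha>_nonneg lam_pos mu_pos p_nonneg p_le_1
      by (simp add: te tw flip: ennreal_plus ennreal_mult)
    then have "e (Suc n) i = ?R" using R e0 by (subst (asm) ennreal_inj) auto
    then show "e (Suc n) i = lam / (lam + mu) * (\<alpha> / (lam + mu) * (p * w n (Suc i) + (1 - p) * w n i) + (p * e n (Suc i) + (1 - p) * e n i))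
      + mu / (lam + mu) * (\<alpha> / (lam + mu) * w n (i - 1) + e n (i - 1))"
    proof -
      have factor: "p * (a * w1 + e1) + (1 - p) * (a * w0 + e0)
          = a * (p * w1 + (1 - p) * w0) + (p * e1 + (1 - p) * e0)" for a w1 e1 w0 e0
        by (simp add: algebra_simps)
      show ?thesis unfolding \<open>e (Suc n) i = ?R\<close> factor ..
    qed
  next
    show "e n i \<le> e (Suc n) i" for n i
      using truncated_mono[of n i] e0 by (simp add: te)
    show "e n i \<le> x0 + \<alpha> * real i / (mu - lam * p)" for n i
    proof -
      have "0 \<le> x0 + \<alpha> * real i / (mu - lam * p)" using x0_nonneg \<alpha>_nonneg drain_rate_pos by simp
      then show ?thesis using truncated_bound[of n i] unfolding te by (subst (asm) ennreal_le_iff)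
    qed
    show "e n 0 = x0" for n using truncated_0[of n] e0 x0_nonneg by (simp add: te)
  qed (use e0 u \<alpha>_nonneg in \<open>auto simp: w_def\<close>)
  have "(\<lambda>n. truncated n i) \<longlonglongrightarrow> (SUP n. truncated n i)"
    by (intro LIMSEQ_SUP incseq_SucI truncated_mono)
  moreover have "(\<lambda>n. truncated n i) \<longlonglongrightarrow> ennreal (x0 + \<alpha> * real i / (mu - lam * p))"
    unfolding te by (intro tendsto_ennrealI lim)
  ultimately show ?thesis by (rule LIMSEQ_unique)
qed

lemma SUP_truncated:
  "(SUP n. truncated n i) = (\<integral>\<^sup>+ \<omega>. (if \<exists>n. empties_within n i \<omega> then ennreal (X i \<omega>) else 0) \<partial>F)"
proof -
  have inc: "incseq (\<lambda>n \<omega>. if empties_within n i \<omega> then ennreal (X i \<omega>) else 0)"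
    using empties_within_mono[of _ i] by (intro incseq_SucI le_funI) (auto simp del: empties_within.simps)
  have "(SUP n. truncated n i) = (\<integral>\<^sup>+ \<omega>. (SUP n. if empties_within n i \<omega> then ennreal (X i \<omega>) else 0) \<partial>F)"
    unfolding truncated_def by (rule nn_integral_monotone_convergence_SUP[symmetric, OF inc]) measurable
  also have "\<dots> = (\<integral>\<^sup>+ \<omega>. (if \<exists>n. empties_within n i \<omega> then ennreal (X i \<omega>) else 0) \<partial>F)"
  proof (intro nn_integral_cong)
    fix \<omega>
    show "(SUP n. if empties_within n i \<omega> then ennreal (X i \<omega>) else 0) = (if \<exists>n. empties_within n i \<omega> then ennreal (X i \<omega>) else 0)"
    proof (cases "\<exists>n. empties_within n i \<omega>")
      case True
      then obtain m where m: "empties_within m i \<omega>" by blast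
      have "(SUP n. if empties_within n i \<omega> then ennreal (X i \<omega>) else 0) = ennreal (X i \<omega>)"
      proof (rule antisym)
        show "ennreal (X i \<omega>) \<le> (SUP n. if empties_within n i \<omega> then ennreal (X i \<omega>) else 0)"
          using m by (intro SUP_upper2[of m]) auto
      qed (intro SUP_least, auto)
      then show ?thesis using True by simp
    qed simp
  qed
  finally show ?thesis .
qed

end

section \<open>Almost sure emptying\<close>

context polling begin

text \<open>For the constant 1 the truncated expectations are the emptying probabilities themselves.
  As \<open>\<alpha> = 0\<close>, their limit is obtained without knowing beforehand that the queue
  empties.\<close>

sublocale emptying: busy_period_functional lam mu p "\<lambda>_ _. 1" 0 1
proof
  interpret F: prob_space F by (rule prob_space_future)
  show "(\<integral>\<^sup>+ \<omega>. ennreal 1 \<partial>F) = ennreal 1" by (simp add: F.emeasure_space_1)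
qed auto

lemma AE_empties: "AE \<omega> in F. \<exists>n. empties_within n i \<omega>"
proof -
  interpret F: prob_space F by (rule prob_space_future)
  have "(\<integral>\<^sup>+ \<omega>. (if \<exists>n. empties_within n i \<omega> then 1 else 0) \<partial>F) = 1"
    using emptying.SUP_truncated[of i] emptying.truncated_limit[of i] by (simp cong: if_cong)
  also have "(\<integral>\<^sup>+ \<omega>. (if \<exists>n. empties_within n i \<omega> then 1 else 0) \<partial>F)
     = (\<integral>\<^sup>+ \<omega>. indicator {\<omega> \<in> space F. \<exists>n. empties_within n i \<omega>} \<omega> \<partial>F)"
    by (intro nn_integral_cong) (auto simp: indicator_def)
  also have "\<dots> = emeasure F {\<omega> \<in> space F. \<exists>n. empties_within n i \<omega>}"
    by (intro nn_integral_indicator) measurable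
  finally have "emeasure F {\<omega> \<in> space F. \<exists>n. empties_within n i \<omega>} = 1" .
  then have "AE \<omega> in F. \<omega> \<in> {\<omega> \<in> space F. \<exists>n. empties_within n i \<omega>}"
    by (intro F.AE_prob_1) (simp add: F.emeasure_eq_measure)
  then show ?thesis by (auto elim!: eventually_mono)
qed

lemma empties_prob_limit: "(\<lambda>n. enn2real (empties_prob n i)) \<longlonglongrightarrow> 1"
proof -
  have eq: "emptying.truncated n i = empties_prob n i" for n
    unfolding emptying.truncated_def empties_prob_def by (simp cong: if_cong)
  have "(\<lambda>n. empties_prob n i) \<longlonglongrightarrow> (SUP n. empties_prob n i)"
    using emptying.truncated_mono[of _ i] unfolding eq by (intro LIMSEQ_SUP incseq_SucI)
  moreover have "(SUP n. empties_prob n i) = ennreal 1"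
    using emptying.truncated_limit[of i] unfolding eq by simp
  ultimately show ?thesis using tendsto_enn2real[of "\<lambda>n. empties_prob n i" 1 sequentially] by simp
qed

end

text \<open>Almost sure emptying removes the restriction in \<open>truncated\<close> and supplies
  the convergence hypothesis of \<open>truncated_limit\<close> for every
  \<open>\<alpha>\<close>.\<close>

lemma (in busy_period_functional) expected_functional:
  "(\<integral>\<^sup>+ \<omega>. ennreal (X i \<omega>) \<partial>F) = ennreal (x0 + \<alpha> * real i / (mu - lam * p))"
proof -
  have "(\<integral>\<^sup>+ \<omega>. ennreal (X i \<omega>) \<partial>F) = (SUP n. truncated n i)"
    unfolding SUP_truncated by (intro nn_integral_cong_AE AE_mp[OF AE_empties[of i] AE_I2]) auto
  then show ?thesis
    using truncated_limit tendsto_mult_left[OF empties_prob_limit, of \<alpha>] by simp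
qed

section \<open>Expected costs\<close>

context polling begin

lemma measurable_service [measurable]: "(\<lambda>\<omega>. snd (snd \<omega>) n) \<in> borel_measurable futures"
  by measurable

lemma expected_service: "(\<integral>\<^sup>+ \<omega>. ennreal (snd (snd \<omega>) n) \<partial>F) = ennreal (1 / mu)"
proof -
  interpret A: prob_space arrivals by (rule prob_space_arrivals)
  interpret C: prob_space choices by (rule prob_space_choices)
  interpret E: prob_space "exponential mu" by (rule prob_space_exponential[OF mu_pos])
  interpret P: product_prob_space "\<lambda>_. exponential mu" "UNIV :: nat set" ..
  have "(\<integral>\<^sup>+ S. ennreal (S n) \<partial>services) = (\<integral>\<^sup>+ x. ennreal x \<partial>distr services (exponential mu) (\<lambda>S. S n))"
    by (subst nn_integral_distr) auto
  also have "\<dots> = ennreal (1 / mu)"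
    unfolding P.PiM_component[OF UNIV_I] by (rule nn_integral_exponential_id[OF mu_pos])
  finally have "(\<integral>\<^sup>+ S. ennreal (S n) \<partial>services) = ennreal (1 / mu)" .
  then show ?thesis
    by (subst nn_integral_future, measurable) (simp add: A.emeasure_space_1 C.emeasure_space_1)
qed

definition length_of_stay :: "nat \<Rightarrow> future \<Rightarrow> real" where
  "length_of_stay i \<omega> = completion_time (snd (snd \<omega>)) (services_until_empty i \<omega>)"

definition later_service :: "nat \<Rightarrow> nat \<Rightarrow> future \<Rightarrow> real" where
  "later_service k i \<omega> = snd (snd \<omega>) (services_until_empty i \<omega> + k)"

lemma measurable_length_of_stay [measurable]: "length_of_stay i \<in> borel_measurable futures"
proof -
  have [measurable]: "(\<lambda>\<omega>. completion_time (snd (snd \<omega>)) m) \<in> borel_measurable futures" for m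
    unfolding completion_time_def by (intro borel_measurable_sum measurable_service)
  show ?thesis unfolding length_of_stay_def
    by (rule measurable_compose_countable) measurable
qed

lemma measurable_later_service [measurable]: "later_service k i \<in> borel_measurable futures"
  unfolding later_service_def by (rule measurable_compose_countable) measurable

sublocale stay: busy_period_functional lam mu p length_of_stay 1 0
proof
  show "0 \<le> length_of_stay i \<omega>" if "regular \<omega>" for i \<omega>
    using that by (auto simp: length_of_stay_def regular_def intro!: completion_time_nonneg)
next
  fix A B S n i assume H: "regular (A, B, S)" "A 0 \<le> S 0" "0 < i"
    "empties_within n (i + of_bool (B 0)) (after_arrival (A, B, S))"
  note N = services_until_empty_arrival[OF H]
  show "length_of_stay i (A, B, S) = 1 * A 0 + length_of_stay (i + of_bool (B 0)) (after_arrival (A, B, S))"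
    using N(2) unfolding length_of_stay_def N(1)[symmetric]
    by (simp add: after_arrival_def completion_time_residual)
next
  fix A B S n i assume H: "regular (A, B, S)" "S 0 < A 0" "0 < i"
    "empties_within n (i - 1) (after_service (A, B, S))"
  show "length_of_stay i (A, B, S) = 1 * S 0 + length_of_stay (i - 1) (after_service (A, B, S))"
    unfolding length_of_stay_def services_until_empty_service[OF H]
    by (simp add: after_service_def completion_time_Suc)
next
  have "(\<integral>\<^sup>+ \<omega>. ennreal (length_of_stay 0 \<omega>) \<partial>F) = (\<integral>\<^sup>+ \<omega>. 0 \<partial>F)"
    by (intro nn_integral_cong_AE AE_mp[OF AE_regular AE_I2])
       (simp add: length_of_stay_def services_until_empty_0 completion_time_def)
  then show "(\<integral>\<^sup>+ \<omega>. ennreal (length_of_stay 0 \<omega>) \<partial>F) = ennreal 0" by simp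
qed auto

text \<open>A service time whose index is the random emptying epoch plus \<open>k\<close>. The first
  event only relabels it, so \<open>\<alpha> = 0\<close>, and its mean \<open>1 / mu\<close> is
  inherited from the start with an empty queue, where the index is deterministic. This plays the
  part of a stopping-time argument.\<close>

sublocale later: busy_period_functional lam mu p "later_service k" 0 "1 / mu" for k
proof
  show "0 \<le> later_service k i \<omega>" if "regular \<omega>" for i \<omega>
    using that by (auto simp: later_service_def regular_def)
next
  fix A B S n i assume H: "regular (A, B, S)" "A 0 \<le> S 0" "0 < i"
    "empties_within n (i + of_bool (B 0)) (after_arrival (A, B, S))"
  note N = services_until_empty_arrival[OF H]
  show "later_service k i (A, B, S) = 0 * A 0 + later_service k (i + of_bool (B 0)) (after_arrival (A, B, S))"
    using N(2) unfolding later_service_def N(1)[symmetric]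
    by (simp add: after_arrival_def residual_def tail_def split: nat.split)
next
  fix A B S n i assume H: "regular (A, B, S)" "S 0 < A 0" "0 < i"
    "empties_within n (i - 1) (after_service (A, B, S))"
  show "later_service k i (A, B, S) = 0 * S 0 + later_service k (i - 1) (after_service (A, B, S))"
    unfolding later_service_def services_until_empty_service[OF H]
    by (simp add: after_service_def tail_def)
next
  have "(\<integral>\<^sup>+ \<omega>. ennreal (later_service k 0 \<omega>) \<partial>F) = (\<integral>\<^sup>+ \<omega>. ennreal (snd (snd \<omega>) k) \<partial>F)"
    by (intro nn_integral_cong_AE AE_mp[OF AE_regular AE_I2])
       (simp add: later_service_def services_until_empty_0)
  then show "(\<integral>\<^sup>+ \<omega>. ennreal (later_service k 0 \<omega>) \<partial>F) = ennreal (1 / mu)" by (simp add: expected_service)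
qed (use mu_pos in auto)

lemma nn_integral_tagged:
  assumes [measurable]: "\<And>s. (\<lambda>\<omega>. f (s, \<omega>)) \<in> borel_measurable futures"
  shows "(\<integral>\<^sup>+ x. f x \<partial>tagged_space lam mu p) = (\<integral>\<^sup>+ s. \<integral>\<^sup>+ \<omega>. f (s, \<omega>) \<partial>F \<partial>measure_pmf \<pi>)"
proof -
  interpret F: prob_space F by (rule prob_space_future)
  have "f \<in> borel_measurable (count_space UNIV \<Otimes>\<^sub>M F)"
    by (rule measurable_pair_measure_countable1) auto
  then have "f \<in> borel_measurable (measure_pmf \<pi> \<Otimes>\<^sub>M F)"
    by (simp cong: measurable_cong_sets sets_pair_measure_cong)
  then show ?thesis unfolding tagged_space_def by (rule F.nn_integral_fst[symmetric])
qed

lemma cost_busy_eq: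
  assumes c: "0 \<le> c"
  shows "cost_busy lam mu c d p = ennreal (c * (mean_busy + 1) / mu)"
proof -
  have inner: "(\<integral>\<^sup>+ \<omega>. ennreal (c * time_served_join_busy (s, \<omega>)) \<partial>F) = ennreal (c * (real (fst s) + 1) / mu)" for s
  proof -
    have "(\<integral>\<^sup>+ \<omega>. ennreal (c * time_served_join_busy (s, \<omega>)) \<partial>F)
       = (\<integral>\<^sup>+ \<omega>. ennreal c * (\<Sum>k<fst s + 1. ennreal (snd (snd \<omega>) k)) \<partial>F)"
      by (intro nn_integral_cong_AE AE_mp[OF AE_regular AE_I2])
         (auto simp: time_served_join_busy_def regular_def c ennreal_mult sum_nonneg split: prod.splits)
    also have "\<dots> = ennreal c * (\<Sum>k<fst s + 1. ennreal (1 / mu))"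
      by (simp add: nn_integral_cmult nn_integral_sum expected_service del: sum.lessThan_Suc)
    also have "\<dots> = ennreal (c * (real (fst s) + 1) / mu)"
      using c mu_pos by (subst sum_ennreal) (auto simp add: algebra_simps add_divide_distrib simp flip: ennreal_mult)
    finally show ?thesis .
  qed
  have "cost_busy lam mu c d p = (\<integral>\<^sup>+ s. ennreal (c * (real (fst s) + 1) / mu) \<partial>measure_pmf \<pi>)"
    unfolding cost_busy_def
  proof (subst nn_integral_tagged)
    show "(\<lambda>\<omega>. ennreal (c * time_served_join_busy (s, \<omega>))) \<in> borel_measurable futures" for s
    proof -
      have "(\<lambda>\<omega>. \<Sum>k<fst s + 1. snd (snd \<omega>) k) \<in> borel_measurable futures"
        by (intro borel_measurable_sum measurable_service)
      then have [measurable]: "(\<lambda>\<omega>. time_served_join_busy (s, \<omega>)) \<in> borel_measurable futures"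
        by (simp add: time_served_join_busy_def split_beta')
      show ?thesis by measurable
    qed
  qed (simp add: inner)
  also have "\<dots> = ennreal (measure_pmf.expectation \<pi> (\<lambda>s. c * (real (fst s) + 1) / mu))"
    using c mu_pos integrable_steady_state by (intro nn_integral_eq_integral) auto
  also have "measure_pmf.expectation \<pi> (\<lambda>s. c * (real (fst s) + 1) / mu) = c * (mean_busy + 1) / mu"
    using integrable_steady_state by (simp add: mean_busy_def)
  finally show ?thesis .
qed

lemma cost_idle_eq:
  assumes c: "0 \<le> c" and d: "0 \<le> d"
  shows "cost_idle lam mu c d p = ennreal (d * mean_busy / (mu - lam * p) + c * (mean_idle + 1) / mu)"
proof -
  have served: "time_served_join_idle (s, \<omega>) = (\<Sum>k<snd s + 1. later_service k (fst s) \<omega>)"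
    and unserved: "time_unserved_join_idle (s, \<omega>) = length_of_stay (fst s) \<omega>" for s \<omega>
    by (auto simp: time_served_join_idle_def time_unserved_join_idle_def later_service_def
          length_of_stay_def split: prod.splits)
  have inner: "(\<integral>\<^sup>+ \<omega>. ennreal (d * time_unserved_join_idle (s, \<omega>) + c * time_served_join_idle (s, \<omega>)) \<partial>F)
     = ennreal (d * real (fst s) / (mu - lam * p) + c * (real (snd s) + 1) / mu)" for s
  proof -
    have "(\<integral>\<^sup>+ \<omega>. ennreal (d * time_unserved_join_idle (s, \<omega>) + c * time_served_join_idle (s, \<omega>)) \<partial>F)
       = (\<integral>\<^sup>+ \<omega>. ennreal d * ennreal (length_of_stay (fst s) \<omega>)
            + ennreal c * (\<Sum>k<snd s + 1. ennreal (later_service k (fst s) \<omega>)) \<partial>F)"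
    proof (intro nn_integral_cong_AE AE_mp[OF AE_regular AE_I2] impI)
      fix \<omega> assume "regular \<omega>"
      then have "0 \<le> length_of_stay (fst s) \<omega>" "\<And>k. 0 \<le> later_service k (fst s) \<omega>"
        by (auto intro: stay.X_nonneg later.X_nonneg)
      then show "ennreal (d * time_unserved_join_idle (s, \<omega>) + c * time_served_join_idle (s, \<omega>))
         = ennreal d * ennreal (length_of_stay (fst s) \<omega>) + ennreal c * (\<Sum>k<snd s + 1. ennreal (later_service k (fst s) \<omega>))"
        unfolding served unserved using c d
        by (subst sum_ennreal) (auto simp: sum_nonneg simp del: sum.lessThan_Suc simp flip: ennreal_mult ennreal_plus)
    qed
    also have "\<dots> = ennreal d * ennreal (real (fst s) / (mu - lam * p)) + ennreal c * (\<Sum>k<snd s + 1. ennreal (1 / mu))"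
      using stay.expected_functional later.expected_functional
      by (simp add: nn_integral_add nn_integral_cmult nn_integral_sum del: sum.lessThan_Suc)
    also have "\<dots> = ennreal (d * (real (fst s) / (mu - lam * p)) + c * (\<Sum>k<snd s + 1. 1 / mu))"
      using c d mu_pos drain_rate_pos
      by (subst sum_ennreal) (auto simp del: sum.lessThan_Suc sum_constant simp: sum_nonneg simp flip: ennreal_mult ennreal_plus)
    finally show ?thesis by (simp add: algebra_simps add_divide_distrib)
  qed
  have "cost_idle lam mu c d p = (\<integral>\<^sup>+ s. ennreal (d * real (fst s) / (mu - lam * p) + c * (real (snd s) + 1) / mu) \<partial>measure_pmf \<pi>)"
    unfolding cost_idle_def
  proof (subst nn_integral_tagged)
    show "(\<lambda>\<omega>. ennreal (d * time_unserved_join_idle (s, \<omega>) + c * time_served_join_idle (s, \<omega>))) \<in> borel_measurable futures" for s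
    proof -
      have [measurable]: "(\<lambda>\<omega>. \<Sum>k<snd s + 1. later_service k (fst s) \<omega>) \<in> borel_measurable futures"
        by (intro borel_measurable_sum measurable_later_service)
      show ?thesis unfolding served unserved by measurable
    qed
  qed (simp add: inner)
  also have "\<dots> = ennreal (measure_pmf.expectation \<pi> (\<lambda>s. d * real (fst s) / (mu - lam * p) + c * (real (snd s) + 1) / mu))"
    using c d mu_pos drain_rate_pos integrable_steady_state by (intro nn_integral_eq_integral) auto
  also have "measure_pmf.expectation \<pi> (\<lambda>s. d * real (fst s) / (mu - lam * p) + c * (real (snd s) + 1) / mu)
     = d * mean_busy / (mu - lam * p) + c * (mean_idle + 1) / mu"
    using integrable_steady_state by (simp add: mean_busy_def mean_idle_def)
  finally show ?thesis .
qed

end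

section \<open>Equilibria and optimal policies\<close>

context polling begin

definition real_cost_busy :: "real \<Rightarrow> real" where
  "real_cost_busy c = c * (mean_busy + 1) / mu"

definition real_cost_idle :: "real \<Rightarrow> real \<Rightarrow> real" where
  "real_cost_idle c d = d * mean_busy / (mu - lam * p) + c * (mean_idle + 1) / mu"

lemma denominator_pos: "0 < mu + lam - 2 * lam * p"
proof -
  have "lam * p \<le> lam" using mult_left_mono[OF p_le_1, of lam] lam_pos by simp
  with lam_less show ?thesis by linarith
qed

lemma means_nonneg: "0 \<le> mean_busy" "0 \<le> mean_idle"
  by (auto simp: mean_busy_def mean_idle_def intro!: integral_nonneg)

lemma expected_cost_eq:
  assumes "0 \<le> c" "0 \<le> d" "q \<in> {0..1}"
  shows "expected_cost lam mu c d q p = ennreal (q * real_cost_busy c + (1 - q) * real_cost_idle c d)"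
    and "0 \<le> q * real_cost_busy c + (1 - q) * real_cost_idle c d"
proof -
  have "0 \<le> real_cost_busy c" "0 \<le> real_cost_idle c d"
    unfolding real_cost_busy_def real_cost_idle_def
    using assms means_nonneg mu_pos drain_rate_pos by auto
  then show "expected_cost lam mu c d q p = ennreal (q * real_cost_busy c + (1 - q) * real_cost_idle c d)"
    "0 \<le> q * real_cost_busy c + (1 - q) * real_cost_idle c d"
    unfolding expected_cost_def cost_busy_eq[OF assms(1)] cost_idle_eq[OF assms(1,2)]
    using assms by (auto simp flip: ennreal_mult ennreal_plus real_cost_busy_def real_cost_idle_def)
qed

text \<open>With the common factor \<open>k\<close>, \<open>mean_busy\<close> equals
  \<open>k * (mu - lam * p)\<close>, so the mean time unserved is exactly \<open>k\<close>, and the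
  two means differ by a multiple of \<open>k\<close> free of \<open>p\<close>. The policy of the
  others thus affects only the size of the difference, never its sign.\<close>

lemma cost_difference:
  "real_cost_idle c d - real_cost_busy c
   = lam / (mu - lam) / (mu + lam - 2 * lam * p) * (d - c * (1 - lam / mu))"
proof -
  define k where "k = lam / (mu - lam) / (mu + lam - 2 * lam * p)"
  have x: "mean_busy = k * (mu - lam * p)" and y: "mean_idle = k * (lam * (1 - p))"
    by (simp_all add: mean_queue_lengths k_def)
  have "real_cost_idle c d - real_cost_busy c = d * mean_busy / (mu - lam * p) + c * (mean_idle - mean_busy) / mu"
    by (simp add: real_cost_idle_def real_cost_busy_def algebra_simps add_divide_distrib diff_divide_distrib)
  also have "d * mean_busy / (mu - lam * p) = k * d"
    using drain_rate_pos by (simp add: x)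
  also have "mean_idle - mean_busy = k * (lam - mu)" by (simp add: x y algebra_simps)
  also have "k * d + c * (k * (lam - mu)) / mu = k * (d - c * (1 - lam / mu))"
    using mu_pos by (simp add: field_simps)
  finally show ?thesis by (simp add: k_def)
qed

text \<open>The terms with \<open>c / mu\<close> add up to \<open>c / (mu - lam)\<close>, the M/M/1
  sojourn time charged at rate \<open>c\<close> throughout. The rest corrects by
  \<open>d - c\<close> the time spent unserved, whose mean is \<open>1 - p\<close> times that of a
  customer joining the idle queue.\<close>

lemma cost_own_policy:
  "p * real_cost_busy c + (1 - p) * real_cost_idle c d
   = c / mu + lam / (mu - lam) * (c / mu + (d - c) * ((1 - p) / (mu + lam - 2 * lam * p)))"
proof -
  define D where "D = mu + lam - 2 * lam * p"
  define k where "k = lam / (mu - lam)"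
  have D: "D \<noteq> 0" using denominator_pos by (simp add: D_def)
  have "p * real_cost_busy c + (1 - p) * real_cost_idle c d
     = real_cost_busy c + (1 - p) * (real_cost_idle c d - real_cost_busy c)" by (simp add: algebra_simps)
  also have "\<dots> = c / mu + (c * (k * (mu - lam * p) / D) / mu + (1 - p) * (k / D * (d - c * (1 - lam / mu))))"
    unfolding cost_difference by (simp add: real_cost_busy_def mean_queue_lengths D_def k_def distrib_left add_divide_distrib)
  also have "c * (k * (mu - lam * p) / D) / mu + (1 - p) * (k / D * (d - c * (1 - lam / mu)))
     = k * ((c * (mu - lam * p) + (1 - p) * (d * mu - c * (mu - lam))) / (mu * D))"
    using D mu_pos by (simp add: field_simps)
  also have "c * (mu - lam * p) + (1 - p) * (d * mu - c * (mu - lam)) = c * D + (d - c) * (1 - p) * mu"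
    by (simp add: D_def algebra_simps)
  also have "(c * D + (d - c) * (1 - p) * mu) / (mu * D) = c / mu + (d - c) * ((1 - p) / D)"
    using D mu_pos by (simp add: add_divide_distrib)
  finally show ?thesis by (simp add: k_def D_def)
qed

end

lemma nash_equilibrium_iff:
  assumes "0 < lam" "lam < mu" "0 \<le> c" "0 \<le> d"
  shows "nash_equilibrium lam mu c d p \<longleftrightarrow>
    p \<in> {0..1} \<and> (\<forall>q\<in>{0..1}. q * (d - c * (1 - lam / mu)) \<le> p * (d - c * (1 - lam / mu)))"
proof (cases "p \<in> {0..1}")
  case True
  interpret polling lam mu p by standard (use assms True in auto)
  define k where "k = lam / (mu - lam) / (mu + lam - 2 * lam * p)"
  have k: "0 < k" using denominator_pos assms by (simp add: k_def)
  have "expected_cost lam mu c d p p \<le> expected_cost lam mu c d q p \<longleftrightarrow>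
      q * (d - c * (1 - lam / mu)) \<le> p * (d - c * (1 - lam / mu))" if q: "q \<in> {0..1}" for q
  proof -
    let ?B = "real_cost_busy c" and ?I = "real_cost_idle c d"
    have "expected_cost lam mu c d p p \<le> expected_cost lam mu c d q p \<longleftrightarrow>
        p * ?B + (1 - p) * ?I \<le> q * ?B + (1 - q) * ?I"
      unfolding expected_cost_eq(1)[OF assms(3,4) q] expected_cost_eq(1)[OF assms(3,4) True]
      by (rule ennreal_le_iff[OF expected_cost_eq(2)[OF assms(3,4) q]])
    also have "\<dots> \<longleftrightarrow> q * (?I - ?B) \<le> p * (?I - ?B)" by (simp add: algebra_simps)
    also have "?I - ?B = k * (d - c * (1 - lam / mu))" unfolding cost_difference k_def ..
    also have "q * (k * (d - c * (1 - lam / mu))) \<le> p * (k * (d - c * (1 - lam / mu)))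
        \<longleftrightarrow> q * (d - c * (1 - lam / mu)) \<le> p * (d - c * (1 - lam / mu))"
      unfolding mult.left_commute[of _ k] using k by (rule mult_le_cancel_left_pos)
    finally show ?thesis .
  qed
  then show ?thesis using True by (simp add: nash_equilibrium_def)
qed (auto simp: nash_equilibrium_def)

lemma socially_optimal_iff:
  assumes "0 < lam" "lam < mu" "0 \<le> c" "0 \<le> d"
  shows "socially_optimal lam mu c d p \<longleftrightarrow> p \<in> {0..1} \<and>
    (\<forall>q\<in>{0..1}. (d - c) * ((1 - p) / (mu + lam - 2 * lam * p)) \<le> (d - c) * ((1 - q) / (mu + lam - 2 * lam * q)))"
proof (cases "p \<in> {0..1}")
  case True
  define S where "S q = c / mu + lam / (mu - lam) * (c / mu + (d - c) * ((1 - q) / (mu + lam - 2 * lam * q)))" for q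
  have S: "expected_cost lam mu c d q q = ennreal (S q)" "0 \<le> S q" if q: "q \<in> {0..1}" for q
  proof -
    interpret polling lam mu q by standard (use assms q in auto)
    show "expected_cost lam mu c d q q = ennreal (S q)" "0 \<le> S q"
      using expected_cost_eq[OF assms(3,4) q] by (simp_all add: cost_own_policy S_def)
  qed
  have k: "0 < lam / (mu - lam)" using assms by simp
  have "expected_cost lam mu c d p p \<le> expected_cost lam mu c d q q \<longleftrightarrow>
      (d - c) * ((1 - p) / (mu + lam - 2 * lam * p)) \<le> (d - c) * ((1 - q) / (mu + lam - 2 * lam * q))"
    if q: "q \<in> {0..1}" for q
  proof -
    have "expected_cost lam mu c d p p \<le> expected_cost lam mu c d q q \<longleftrightarrow> S p \<le> S q"
      unfolding S(1)[OF True] S(1)[OF q] by (rule ennreal_le_iff[OF S(2)[OF q]])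
    then show ?thesis unfolding S_def add_le_cancel_left mult_le_cancel_left_pos[OF k] .
  qed
  then show ?thesis using True by (simp add: socially_optimal_def)
qed (auto simp: socially_optimal_def)

text \<open>The bounds are the values at \<open>q = 1\<close> and \<open>q = 0\<close>, the two
  policies that compete for social optimality. After cross-multiplication the upper one leaves the
  slack \<open>q * (mu - lam)\<close>.\<close>

lemma idle_fraction_bounds:
  fixes lam mu q :: real
  assumes "0 < lam" "lam < mu" "q \<in> {0..1}"
  shows "0 \<le> (1 - q) / (mu + lam - 2 * lam * q)" "(1 - q) / (mu + lam - 2 * lam * q) \<le> 1 / (mu + lam)"
proof -
  interpret polling lam mu q by standard (use assms in auto)
  show "0 \<le> (1 - q) / (mu + lam - 2 * lam * q)" using denominator_pos p_le_1 by simp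
  have "0 \<le> q * (mu - lam)" using assms by simp
  then have "(1 - q) * (mu + lam) \<le> 1 * (mu + lam - 2 * lam * q)" by (simp add: algebra_simps)
  then show "(1 - q) / (mu + lam - 2 * lam * q) \<le> 1 / (mu + lam)"
    using denominator_pos assms by (simp add: divide_le_eq le_divide_eq pos_divide_le_eq mult.commute)
qed

text \<open>Uniqueness of the equilibrium is qualified by two ties: if
  \<open>c * (1 - rho) = d\<close>, a customer is indifferent and every policy is an equilibrium; if
  \<open>c = d = 0\<close>, all policies are free of cost.\<close>

theorem theorem4p3:
  fixes lam mu rho c d :: real
  assumes "lam > 0" and "mu > 0" and "rho = lam / mu" and "rho < 1"
    and "c \<ge> 0" and "d \<ge> 0"
  shows "(c * (1 - rho) > d \<longrightarrow>
            (\<forall>p. nash_equilibrium lam mu c d p \<longleftrightarrow> p = 0) \<and>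
            socially_optimal lam mu c d 0) \<and>
         (c * (1 - rho) \<le> d \<and> d < c \<longrightarrow>
            nash_equilibrium lam mu c d 1 \<and>
            (c * (1 - rho) \<noteq> d \<longrightarrow> (\<forall>p. nash_equilibrium lam mu c d p \<longrightarrow> p = 1)) \<and>
            \<not> socially_optimal lam mu c d 1) \<and>
         (c \<le> d \<longrightarrow>
            nash_equilibrium lam mu c d 1 \<and>
            (c > 0 \<or> d > 0 \<longrightarrow> (\<forall>p. nash_equilibrium lam mu c d p \<longrightarrow> p = 1)) \<and>
            socially_optimal lam mu c d 1)"
proof -
  have less: "lam < mu" using assms by (simp add: divide_less_eq)
  have rho: "0 < rho" using assms by simp
  define \<delta> where "\<delta> = d - c * (1 - rho)"
  have nash: "nash_equilibrium lam mu c d p \<longleftrightarrow> p \<in> {0..1} \<and> (\<forall>q\<in>{0..1}. q * \<delta> \<le> p * \<delta>)" for p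
    unfolding \<delta>_def assms(3) by (rule nash_equilibrium_iff) (use assms less in auto)
  note social = socially_optimal_iff[OF assms(1) less assms(5,6)]
  have nash_idle: "nash_equilibrium lam mu c d p \<longleftrightarrow> p = 0" if "\<delta> < 0" for p
    unfolding nash using that by (auto simp: mult_le_cancel_right dest!: bspec[of _ _ 0])
  have nash_busy: "nash_equilibrium lam mu c d 1" if "0 \<le> \<delta>"
    unfolding nash using that by (auto intro: mult_left_le_one_le)
  have nash_busy_only: "p = 1" if "0 < \<delta>" "nash_equilibrium lam mu c d p" for p
    using that unfolding nash by (auto simp: mult_le_cancel_right dest!: bspec[of _ _ 1])
  \<comment> \<open>In the first case this yields \<open>d < c\<close>, so that
    \<open>opt_idle\<close> applies.\<close>
  have "c * (1 - rho) \<le> c" using assms(5) rho by (simp add: algebra_simps)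
  have "c * (1 - rho) < c" if "0 < c" using that rho by (simp add: algebra_simps)
  \<comment> \<open>Strictness has two sources: \<open>rho > 0\<close> when \<open>c > 0\<close>,
    and \<open>d > 0\<close> when \<open>c = 0\<close>.\<close>
  then have busy_pos: "0 < \<delta>" if "c \<le> d" "c > 0 \<or> d > 0"
  proof (cases "c = 0")
    case False
    then have "c * (1 - rho) < c" using \<open>0 < c \<Longrightarrow> c * (1 - rho) < c\<close> assms(5) by simp
    then show ?thesis using that(1) by (simp add: \<delta>_def)
  qed (use that in \<open>simp add: \<delta>_def\<close>)
  have opt_idle: "socially_optimal lam mu c d 0" if "d < c"
    unfolding social
  proof (intro conjI ballI mult_left_mono_neg)
    show "(1 - q) / (mu + lam - 2 * lam * q) \<le> (1 - 0) / (mu + lam - 2 * lam * 0)" if "q \<in> {0..1}" for q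
      using idle_fraction_bounds(2)[OF assms(1) less that] by simp
  qed (use that in auto)
  have opt_busy: "socially_optimal lam mu c d 1" if "c \<le> d"
    unfolding social
  proof (intro conjI ballI mult_left_mono)
    show "(1 - 1) / (mu + lam - 2 * lam * 1) \<le> (1 - q) / (mu + lam - 2 * lam * q)" if "q \<in> {0..1}" for q
      using idle_fraction_bounds(1)[OF assms(1) less that] by simp
  qed (use that in auto)
  have not_opt_busy: "\<not> socially_optimal lam mu c d 1" if "d < c"
  proof
    assume "socially_optimal lam mu c d 1"
    then have "0 \<le> (d - c) * (1 / (mu + lam))" unfolding social by (auto dest!: bspec[of _ _ 0])
    moreover have "(d - c) * (1 / (mu + lam)) < 0" using that assms(1,2) by (intro mult_neg_pos) auto
    ultimately show False by simp
  qed
  show ?thesis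
    using nash_idle nash_busy nash_busy_only busy_pos opt_idle opt_busy not_opt_busy \<open>c * (1 - rho) \<le> c\<close>
    unfolding \<delta>_def by (smt (verit))
qed

end
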